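(* Let $n\ge 3$ and $0\le g\le n/2$ be integers. (i) If $g<n/2$, then the fixed genus chord swap chain on $\mathcal{X}_{n,g}$ is irreducible. (ii) If $g=n/2$, then the fixed genus chord swap chain on $\mathcal{X}_{n,g}$ has exactly two communicating classes: one consisting only of the Bolza diagram (an isolated point), and one consisting of all other chord diagrams in $\mathcal{X}_{n,g}$.
   Context: Chord diagrams. Let $P$ be a regular polygon with $2n$ vertices, labelled clockwise $1,\dots,2n$ (indices modulo $2n$), and hence $2n$ sides $\{x,x+1\}$. A chord is an unordered pair of distinct sides. A chord diagram $X$ is a set of $n$ chords forming a perfect matching of the $2n$ sides of $P$. The Bolza diagram is the chord diagram which matches together opposite sides of $P$; it has genus $\lfloor n/2\rfloor$. Genus. The genus of a chord diagram is the genus of the closed orientable surface obtained by gluing the sides of $P$ in pairs according to the chords, compatibly with orientation (a chord $\{\{x,x+1\},\{y,y+1\}\}$ identifies vertex $x$ with $y+1$ and vertex $y$ with $x+1$). Equivalently, if $V$ is the number of classes of vertices of $P$ after these identifications, the genus is $g=(n+1-V)/2$. $\mathcal{X}_{n,g}$ is the set of all chord diagrams with $n$ chords and genus $g$. Chord swap. $Y$ is a chord swap of $X$ if there are two distinct chords $\{A,B\},\{C,D\}\in X$ such that $Y=(X\setminus\{\{A,B\},\{C,D\}\})\cup\{\{A,C\},\{B,D\}\}$ or $Y=(X\setminus\{\{A,B\},\{C,D\}\})\cup\{\{A,D\},\{B,C\}\}$. The chain. The fixed genus chord swap chain on $\mathcal{X}_{n,g}$ is the Markov chain with transition kernel $P(X,Y)=\frac{1}{4\binom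 n2}$ if $Y$ is a chord swap of $X$ (with $X,Y\in\mathcal{X}_{n,g}$), $P(X,Y)=0$ for other $Y\ne X$, and $P(X,X)=1-\sum_{Z\in\mathcal{X}_{n,g}\setminus\{X\}}P(X,Z)$. *)

theory Defs
  imports Complex_Main
begin

text \<open>
  Vertices of the \<open>2n\<close>-gon are the residues modulo \<open>2n\<close>, represented by \<open>0, \<dots>, 2n - 1\<close>
  (so the vertex labelled \<open>2n\<close> is \<open>0\<close>). The number \<open>x\<close> also names the side \<open>{x, x + 1}\<close>.
\<close>

definition polygon :: "nat \<Rightarrow> nat set" where
  "polygon n = {0..<2 * n}"

type_synonym diagram = "nat set set"

definition chord :: "nat \<Rightarrow> nat set \<Rightarrow> bool" where
  "chord n c \<longleftrightarrow> c \<subseteq> polygon n \<and> card c = 2"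

definition chord_diagram :: "nat \<Rightarrow> diagram \<Rightarrow> bool" where
  "chord_diagram n X \<longleftrightarrow>
     (\<forall>c\<in>X. chord n c) \<and> card X = n \<and> (\<forall>s\<in>polygon n. \<exists>!c. c \<in> X \<and> s \<in> c)"

definition bolza :: "nat \<Rightarrow> diagram" where
  "bolza n = {{x, x + n} | x. x < n}"

text \<open>
  Gluing side \<open>{a, a + 1}\<close> to side \<open>{b, b + 1}\<close> compatibly with orientation identifies
  \<open>a\<close> with \<open>b + 1\<close>, and \<open>b\<close> with \<open>a + 1\<close>; the second pair is obtained below by exchanging
  the roles of \<open>a\<close> and \<open>b\<close>.
\<close>

definition vertex_gluing :: "nat \<Rightarrow> diagram \<Rightarrow> (nat \<times> nat) set" where
  "vertex_gluing n X = {(a, (b + 1) mod (2 * n)) | a b. {a, b} \<in> X}"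

definition vertex_classes :: "nat \<Rightarrow> diagram \<Rightarrow> nat set set" where
  "vertex_classes n X =
     polygon n // (vertex_gluing n X \<union> (vertex_gluing n X)\<inverse>)\<^sup>*"

text \<open>
  The glued surface has \<open>V = card (vertex_classes n X)\<close> vertices, \<open>n\<close> edges and one face, so
  its Euler characteristic is \<open>V - n + 1 = 2 - 2g\<close>. The genus is a real number here only
  so that the division is exact.
\<close>

definition genus :: "nat \<Rightarrow> diagram \<Rightarrow> real" where
  "genus n X = (real n + 1 - real (card (vertex_classes n X))) / 2"

definition fixed_genus :: "nat \<Rightarrow> nat \<Rightarrow> diagram set" where
  "fixed_genus n g = {X. chord_diagram n X \<and> genus n X = real g}"

fun kernel_pow :: "'a set \<Rightarrow> ('a \<Rightarrow> 'a \<Rightarrow> real) \<Rightarrow> nat \<Rightarrow> 'a \<Rightarrow> 'a \<Rightarrow> real" where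
  "kernel_pow S P 0 x y = (if x = y then 1 else 0)"
| "kernel_pow S P (Suc t) x y = (\<Sum>z\<in>S. P x z * kernel_pow S P t z y)"

definition accessible :: "'a set \<Rightarrow> ('a \<Rightarrow> 'a \<Rightarrow> real) \<Rightarrow> 'a \<Rightarrow> 'a \<Rightarrow> bool" where
  "accessible S P x y \<longleftrightarrow> (\<exists>t. kernel_pow S P t x y > 0)"

definition irreducible_chain :: "'a set \<Rightarrow> ('a \<Rightarrow> 'a \<Rightarrow> real) \<Rightarrow> bool" where
  "irreducible_chain S P \<longleftrightarrow> (\<forall>x\<in>S. \<forall>y\<in>S. accessible S P x y)"

definition communicating_classes :: "'a set \<Rightarrow> ('a \<Rightarrow> 'a \<Rightarrow> real) \<Rightarrow> 'a set set" where
  "communicating_classes S P =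
     S // {(x, y). x \<in> S \<and> y \<in> S \<and> accessible S P x y \<and> accessible S P y x}"

definition isolated_state :: "'a set \<Rightarrow> ('a \<Rightarrow> 'a \<Rightarrow> real) \<Rightarrow> 'a \<Rightarrow> bool" where
  "isolated_state S P x \<longleftrightarrow> x \<in> S \<and> (\<forall>y\<in>S - {x}. P x y = 0 \<and> P y x = 0)"

definition chord_swap :: "diagram \<Rightarrow> diagram \<Rightarrow> bool" where
  "chord_swap X Y \<longleftrightarrow>
     (\<exists>a b c d. {a, b} \<in> X \<and> {c, d} \<in> X \<and> {a, b} \<noteq> {c, d} \<and>
        (Y = (X - {{a, b}, {c, d}}) \<union> {{a, c}, {b, d}} \<or>
         Y = (X - {{a, b}, {c, d}}) \<union> {{a, d}, {b, c}}))"

definition swap_prob :: "nat \<Rightarrow> diagram \<Rightarrow> diagram \<Rightarrow> real" where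
  "swap_prob n X Y = (if chord_swap X Y then 1 / (4 * real (n choose 2)) else 0)"

definition swap_chain :: "nat \<Rightarrow> nat \<Rightarrow> diagram \<Rightarrow> diagram \<Rightarrow> real" where
  "swap_chain n g X Y =
     (if X = Y then 1 - (\<Sum>Z\<in>fixed_genus n g - {X}. swap_prob n X Z)
      else if X \<in> fixed_genus n g \<and> Y \<in> fixed_genus n g then swap_prob n X Y
      else 0)"

end

theory Submission
  imports Defs "HOL-Combinatorics.Orbits"
begin

text \<open>
  A chord diagram is a fixed-point-free involution \<open>\<alpha>\<close> of the sides, and its vertices are the
  cycles of \<open>\<phi> = rot \<circ> \<alpha>\<close>. A chord swap multiplies \<open>\<phi>\<close> by two disjoint transpositions, each of
  which splits or merges cycles, so it keeps the genus iff one of them splits and the other merges.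

  With at least two vertices, at most two genus-preserving swaps produce a leaf (a chord joining
  adjacent sides). Leaves can be slid around the polygon, and deleting one lowers both \<open>n\<close> and the
  number of vertices by one. With a single vertex, list the sides in the cyclic order of \<open>\<phi>\<close>. If
  the chords of any two adjacent sides cross in this order, then the chord involution is a strictly
  increasing map of the cyclic order and hence a rotation, which is the Bolza diagram; they cannot
  all be non-crossing either. Where the behaviour changes, a swap makes a chord enclose a single
  side, whose own chord can then be shortened to a handle \<open>abab\<close>. Handles can be slid and deleted
  like leaves. A Bolza diagram left over after a deletion is turned into another diagram by an
  explicit path that uses the extra leaf or handle.

  In the Bolza diagram every chord swap changes the number of vertices, so it is isolated.
\<close>

section \<open>Cycles of a permutation times a transposition\<close>

text \<open>Since V = n + 1 - 2g, part (i) is the case of at least two vertices and part (ii) the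
  case of a single one, where n is even. A leaf has a vertex of its own, so a one-vertex diagram
  contains none; this is why handles, which add no vertex, take over there. The two cases are
  linked: deleting a leaf from a diagram with two vertices leaves one vertex, where connectivity
  fails because of the Bolza diagram, so part (i) depends on the one-vertex case for fewer chords.
  The escape paths need at least four remaining chords. With two, the Bolza diagram is the only
  one-vertex diagram and nothing has to be connected. Evenness of n also identifies the Bolza
  diagram: its vertex permutation is the translation by n + 1, and n + 1 is its own inverse modulo
  2n. The argument is about functions on \<open>nat\<close> that fix everything outside the polygon;
  diagrams, genus and kernel are attached only at the end. Pieces are always deleted at the last
  sides, so that no other side has to be renamed.\<close>

lemma orbit_subset_closed:
  assumes "x \<in> S" "\<And>y. y \<in> S \<Longrightarrow> f y \<in> S"
  shows "orbit f x \<subseteq> S"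
proof
  fix y assume "y \<in> orbit f x"
  then show "y \<in> S" by induction (auto intro: assms)
qed

lemma orbit_eq_iff:
  assumes "permutation f"
  shows "orbit f x = orbit f y \<longleftrightarrow> x \<in> orbit f y"
  by (metis assms orbit_swap orbit_trans permutation_self_in_orbit subsetI subset_antisym)

lemma orbit_sym:
  assumes "permutation f" "x \<in> orbit f y"
  shows "y \<in> orbit f x"
  using assms by (metis orbit_eq_iff)

lemma permutation_transpose_comp:
  assumes "permutation f"
  shows "permutation (f \<circ> transpose a b)"
  using assms by (intro permutation_compose permutation_swap_id)

lemma orbit_transpose_subset:
  assumes "permutation f" "b \<in> orbit f a"
  shows "orbit (f \<circ> transpose a b) x \<subseteq> orbit f x"
proof (rule orbit_subset_closed)
  show "x \<in> orbit f x" by (rule permutation_self_in_orbit[OF assms(1)])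
next
  fix y assume y: "y \<in> orbit f x"
  have "transpose a b y \<in> orbit f y"
    using assms orbit_sym[OF assms] permutation_self_in_orbit[OF assms(1)]
    by (auto simp: transpose_def)
  then have "transpose a b y \<in> orbit f x" using y by (rule orbit_trans)
  then show "(f \<circ> transpose a b) y \<in> orbit f x" by (auto intro: orbit.step)
qed

text \<open>Under the product \<open>b\<close> is sent to \<open>f a\<close>, so the arc of the old
  cycle from \<open>f a\<close> to the next visit of \<open>b\<close> closes up on itself, and
  \<open>a\<close> is not on that arc.\<close>

lemma orbit_transpose_split:
  assumes "permutation f" "a \<noteq> b" "b \<in> orbit f a"
  shows "a \<notin> orbit (f \<circ> transpose a b) b"
proof -
  let ?g = "f \<circ> transpose a b"
  define d where "d = (LEAST i. 0 < i \<and> (f ^^ i) a = b)"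
  have ex: "\<exists>i. 0 < i \<and> (f ^^ i) a = b" using assms(3) by (auto simp: orbit_altdef)
  have d: "0 < d" "(f ^^ d) a = b"
    unfolding d_def using LeastI_ex[OF ex] by auto
  have least: "(f ^^ i) a \<noteq> b" if "0 < i" "i < d" for i
    using that not_less_Least unfolding d_def by blast
  \<comment> \<open>Returning to \<open>a\<close> at time \<open>i\<close> would bring the visit of
    \<open>b\<close> forward to time \<open>d - i\<close>.\<close>
  have not_a: "(f ^^ i) a \<noteq> a" if "0 < i" "i \<le> d" for i
  proof
    assume i: "(f ^^ i) a = a"
    then have "i \<noteq> d" using d assms(2) by auto
    then have "i < d" using that by simp
    have "(f ^^ (d - i)) a = (f ^^ (d - i)) ((f ^^ i) a)" by (simp add: i)
    also have "\<dots> = (f ^^ (d - i + i)) a" by (simp only: funpow_add o_apply)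
    also have "\<dots> = b" using d that by simp
    finally show False using least[of "d - i"] \<open>i < d\<close> that by simp
  qed
  let ?S = "{(f ^^ i) a | i. 0 < i \<and> i \<le> d}"
  have "orbit ?g b \<subseteq> ?S"
  proof (rule orbit_subset_closed)
    show "b \<in> ?S" using d by blast
  next
    fix y assume "y \<in> ?S"
    then obtain i where i: "0 < i" "i \<le> d" "y = (f ^^ i) a" by blast
    show "?g y \<in> ?S"
    proof (cases "i = d")
      case True
      then have "?g y = (f ^^ 1) a" using i d by simp
      then show ?thesis using d by force
    next
      case False
      then have "?g y = (f ^^ Suc i) a" using i least[of i] not_a[of i] by simp
      moreover have "Suc i \<le> d" using False i by simp
      ultimately show ?thesis by blast
    qed
  qed
  moreover have "a \<notin> ?S"
  proof
    assume "a \<in> ?S"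
    then obtain i where "0 < i" "i \<le> d" "(f ^^ i) a = a" by fastforce
    then show False using not_a by blast
  qed
  ultimately show ?thesis by blast
qed

text \<open>The new orbit of \<open>a\<close> enters the old cycle of \<open>b\<close> at
  \<open>f b\<close>. That cycle does not contain \<open>a\<close>, so the new map follows it
  unchanged until \<open>b\<close> is reached.\<close>

lemma orbit_transpose_merge:
  assumes "permutation f" "b \<notin> orbit f a"
  shows "b \<in> orbit (f \<circ> transpose a b) a"
proof -
  let ?g = "f \<circ> transpose a b"
  have "y \<in> orbit ?g a" if "y \<in> orbit f b" for y
    using that
  proof induction
    case base
    have "f b = ?g a" by simp
    then show ?case by (simp only: orbit.base)
  next
    case (step y)
    have "y \<noteq> a" using step.hyps assms orbit_sym by metis
    show ?case
    proof (cases "y = b")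
      case True
      then have "f y = ?g a" by simp
      then show ?thesis by (simp only: orbit.base)
    next
      case False
      then have "f y = ?g y" using \<open>y \<noteq> a\<close> by simp
      then show ?thesis using step.IH by (simp only: orbit.step)
    qed
  qed
  then show ?thesis using permutation_self_in_orbit[OF assms(1)] by blast
qed

text \<open>Cycles are counted as sets of points, so that a fixed point is a cycle of its
  own.\<close>

definition num_cycles :: "'a set \<Rightarrow> ('a \<Rightarrow> 'a) \<Rightarrow> nat" where
  "num_cycles A f = card (orbit f ` A)"

text \<open>Off the cycle of \<open>a\<close> nothing changes; that one cycle is replaced by the two
  new orbits of \<open>a\<close> and \<open>b\<close>.\<close>

lemma num_cycles_split:
  assumes f: "f permutes A" "finite A" and a: "a \<in> A" and "a \<noteq> b" "b \<in> orbit f a"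
  shows "num_cycles A (f \<circ> transpose a b) = num_cycles A f + 1"
proof -
  let ?g = "f \<circ> transpose a b"
  have pf: "permutation f" using f by (auto simp: permutation_permutes)
  then have pg: "permutation ?g" by (rule permutation_transpose_comp)
  have self: "x \<in> orbit f x" "x \<in> orbit ?g x" for x
    by (rule permutation_self_in_orbit; fact)+
  have sub: "orbit ?g x \<subseteq> orbit f x" for x
    by (rule orbit_transpose_subset) fact+
  have oa: "orbit f a = orbit ?g a \<union> orbit ?g b"
  proof
    show "orbit f a \<subseteq> orbit ?g a \<union> orbit ?g b"
    proof (rule orbit_subset_closed)
      fix y assume y: "y \<in> orbit ?g a \<union> orbit ?g b"
      consider "y = a" | "y = b" | "f y = ?g y" by (cases "y = a \<or> y = b") auto
      then show "f y \<in> orbit ?g a \<union> orbit ?g b"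
      proof cases
        case 1
        then have "f y = ?g b" by simp
        then show ?thesis by (metis UnCI orbit.base)
      next
        case 2
        then have "f y = ?g a" by simp
        then show ?thesis by (metis UnCI orbit.base)
      next
        case 3
        then show ?thesis using y orbit.step by (metis UnE UnI1 UnI2)
      qed
    qed (use self in blast)
    have "orbit ?g b \<subseteq> orbit f a"
      using sub[of b] orbit_eq_iff[OF pf, of b a] assms(5) by simp
    then show "orbit ?g a \<union> orbit ?g b \<subseteq> orbit f a" using sub[of a] by simp
  qed
  have b: "b \<in> A" using permutes_orbit_subset[OF f(1) a] assms(5) by blast
  let ?B = "A - orbit f a"
  have oA: "orbit f a \<subseteq> A" by (rule permutes_orbit_subset[OF f(1) a])
  have eq: "orbit ?g x = orbit f x" if "x \<in> ?B" for x
  proof (rule orbit_cong[OF self(1)])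
    fix y assume "y \<in> orbit f x"
    then have "y \<notin> orbit f a"
      using that orbit_trans[OF orbit_sym[OF pf \<open>y \<in> orbit f x\<close>], of a] by blast
    then have "y \<noteq> a" "y \<noteq> b" using assms(5) self(1) by auto
    then show "?g y = f y" by simp
  qed
  have f1: "orbit f ` A = insert (orbit f a) (orbit f ` ?B)"
    using a orbit_eq_iff[OF pf] by blast
  have f2: "orbit f a \<notin> orbit f ` ?B"
    using orbit_eq_iff[OF pf] self(1) by blast
  have "orbit ?g ` A = orbit ?g ` orbit f a \<union> orbit ?g ` ?B" using oA by blast
  also have "orbit ?g ` ?B = orbit f ` ?B" using eq by simp
  also have "orbit ?g ` orbit f a = {orbit ?g a, orbit ?g b}"
    unfolding oa using orbit_eq_iff[OF pg] self(2) by blast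
  finally have g1: "orbit ?g ` A = insert (orbit ?g a) (insert (orbit ?g b) (orbit f ` ?B))"
    by (simp only: Un_insert_left Un_empty_left)
  have ab: "orbit ?g a \<noteq> orbit ?g b"
    using orbit_transpose_split[OF pf assms(4,5)] self(2) by blast
  have not_in: "orbit ?g c \<notin> orbit f ` ?B" if "c \<in> orbit f a" for c
  proof
    assume "orbit ?g c \<in> orbit f ` ?B"
    then obtain x where "x \<in> ?B" "c \<in> orbit f x" using self(2)[of c] by blast
    then show False
      using orbit_trans[OF orbit_sym[OF pf \<open>c \<in> orbit f x\<close>] that] by simp
  qed
  have "orbit ?g a \<notin> orbit f ` ?B" "orbit ?g b \<notin> orbit f ` ?B"
    by (rule not_in; use assms(5) self(1) in simp)+
  moreover have "finite (orbit f ` ?B)" using f(2) by simp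
  ultimately show ?thesis unfolding num_cycles_def f1 g1 using ab f2 by simp
qed

text \<open>Multiplying by the same transposition once more undoes the merge, so this is the split
  count read backwards.\<close>

lemma num_cycles_merge:
  assumes "f permutes A" "finite A" "a \<in> A" "b \<in> A" "b \<notin> orbit f a"
  shows "num_cycles A (f \<circ> transpose a b) + 1 = num_cycles A f"
proof -
  let ?g = "f \<circ> transpose a b"
  have pf: "permutation f" using assms by (auto simp: permutation_permutes)
  have "a \<noteq> b" using assms(5) permutation_self_in_orbit[OF pf] by auto
  have "?g permutes A" using assms by (intro permutes_compose permutes_swap_id)
  then have "num_cycles A (?g \<circ> transpose a b) = num_cycles A ?g + 1"
    using assms orbit_transpose_merge[OF pf assms(5)] \<open>a \<noteq> b\<close> by (intro num_cycles_split)
  moreover have "?g \<circ> transpose a b = f" by (simp add: fun_eq_iff)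
  ultimately show ?thesis by simp
qed

lemma orbit_transpose_superset:
  assumes "permutation f" "b \<notin> orbit f a"
  shows "orbit f x \<subseteq> orbit (f \<circ> transpose a b) x"
proof -
  have "f = f \<circ> transpose a b \<circ> transpose a b" by (simp add: fun_eq_iff)
  then show ?thesis
    using orbit_transpose_subset[OF permutation_transpose_comp[OF assms(1)] orbit_transpose_merge[OF assms], of x]
    by simp
qed

lemma num_cycles_Suc_0_iff:
  assumes "f permutes A" "finite A" "A \<noteq> {}"
  shows "num_cycles A f = Suc 0 \<longleftrightarrow> (\<forall>x\<in>A. \<forall>y\<in>A. x \<in> orbit f y)"
proof -
  have pf: "permutation f" using assms by (auto simp: permutation_permutes)
  obtain a where a: "a \<in> A" using assms by blast
  have "num_cycles A f = Suc 0 \<longleftrightarrow> (\<forall>x\<in>A. \<forall>y\<in>A. orbit f x = orbit f y)"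
  proof
    assume "num_cycles A f = Suc 0"
    then show "\<forall>x\<in>A. \<forall>y\<in>A. orbit f x = orbit f y"
      unfolding num_cycles_def by (metis card_1_singletonE imageI singletonD One_nat_def)
  next
    assume "\<forall>x\<in>A. \<forall>y\<in>A. orbit f x = orbit f y"
    then have "orbit f ` A = {orbit f a}" using a by blast
    then show "num_cycles A f = Suc 0" by (simp add: num_cycles_def)
  qed
  then show ?thesis using orbit_eq_iff[OF pf] by simp
qed

section \<open>Matchings and chord swaps\<close>

text \<open>Fixed outside the polygon, so that it is a permutation in the sense of
  \<open>permutes\<close>; \<open>matching\<close> follows the same convention.\<close>

definition rot :: "nat \<Rightarrow> nat \<Rightarrow> nat" where
  "rot n x = (if x < 2 * n then (x + 1) mod (2 * n) else x)"

lemma rot_eq: "x < 2 * n \<Longrightarrow> rot n x = (if Suc x = 2 * n then 0 else Suc x)"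
  by (auto simp: rot_def)

lemma rot_less [simp]: "rot n x < 2 * n \<longleftrightarrow> x < 2 * n"
  by (auto simp: rot_def)

lemma rot_inj: "rot n x = rot n y \<Longrightarrow> x = y"
  by (cases "x < 2 * n"; cases "y < 2 * n")
     (auto simp: rot_eq split: if_splits, auto simp: rot_def split: if_splits)

lemma rot_permutes: "rot n permutes {..<2 * n}"
proof (rule bij_imp_permutes)
  have "inj_on (rot n) {..<2 * n}" by (auto intro: inj_onI rot_inj)
  then show "bij_betw (rot n) {..<2 * n} {..<2 * n}"
    using endo_inj_surj[of "{..<2 * n}" "rot n"] by (simp add: bij_betw_def image_subset_iff)
qed (simp add: rot_def)

lemma rot_neq:
  assumes "x < 2 * n"
  shows "rot n x \<noteq> x"
    and "n \<ge> 2 \<Longrightarrow> rot n (rot n x) \<noteq> x"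
    and "n \<ge> 2 \<Longrightarrow> rot n (rot n (rot n x)) \<noteq> x"
    and "n \<ge> 3 \<Longrightarrow> rot n (rot n (rot n (rot n x))) \<noteq> x"
  using assms by (auto simp: rot_eq; presburger)+

lemma rot_funpow: "x < 2 * n \<Longrightarrow> (rot n ^^ k) x = (x + k) mod (2 * n)"
  by (induction k) (auto simp: rot_def mod_simps)

lemma rot_transitive:
  assumes "x < 2 * n" "y < 2 * n"
  obtains k where "(rot n ^^ k) x = y"
proof
  show "(rot n ^^ (2 * n - x + y)) x = y"
    using assms by (simp add: rot_funpow)
qed

definition matching :: "nat \<Rightarrow> (nat \<Rightarrow> nat) \<Rightarrow> bool" where
  "matching n \<alpha> \<longleftrightarrow>
     \<alpha> permutes {..<2 * n} \<and> (\<forall>x<2 * n. \<alpha> x \<noteq> x) \<and> (\<forall>x. \<alpha> (\<alpha> x) = x)"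

lemma matchingD:
  assumes "matching n \<alpha>"
  shows "\<alpha> permutes {..<2 * n}" "x < 2 * n \<Longrightarrow> \<alpha> x \<noteq> x" "\<alpha> (\<alpha> x) = x"
    "\<alpha> x < 2 * n \<longleftrightarrow> x < 2 * n" "\<alpha> x = \<alpha> y \<longleftrightarrow> x = y" "x \<ge> 2 * n \<Longrightarrow> \<alpha> x = x"
proof -
  show "\<alpha> x < 2 * n \<longleftrightarrow> x < 2 * n"
    using assms permutes_in_image[of \<alpha> "{..<2 * n}" x] by (simp add: matching_def)
  show "\<alpha> x = \<alpha> y \<longleftrightarrow> x = y" using assms unfolding matching_def by metis
  show "\<alpha> x = x" if "x \<ge> 2 * n"
    using assms that permutes_not_in[of \<alpha> "{..<2 * n}" x] by (simp add: matching_def)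
qed (use assms in \<open>auto simp: matching_def\<close>)

lemma matchingI:
  assumes "\<And>x. x < 2 * n \<Longrightarrow> \<alpha> x < 2 * n" "\<And>x. x < 2 * n \<Longrightarrow> \<alpha> x \<noteq> x"
    "\<And>x. x < 2 * n \<Longrightarrow> \<alpha> (\<alpha> x) = x" "\<And>x. x \<ge> 2 * n \<Longrightarrow> \<alpha> x = x"
  shows "matching n \<alpha>"
proof -
  have inv: "\<alpha> (\<alpha> x) = x" for x
    using assms by (cases "x < 2 * n") auto
  moreover have "\<alpha> permutes {..<2 * n}"
    unfolding permutes_def
  proof (intro conjI allI impI ex1I)
    fix x show "\<alpha> (\<alpha> x) = x" by (rule inv)
    show "\<alpha> x = x" if "x \<notin> {..<2 * n}" using that assms by simp
    show "y = \<alpha> x" if "\<alpha> y = x" for y using that inv by auto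
  qed
  ultimately show ?thesis using assms by (simp add: matching_def)
qed

text \<open>The side \<open>x\<close> starts at the vertex \<open>x\<close>. Gluing it to
  \<open>\<alpha> x\<close> identifies this vertex with the end vertex of \<open>\<alpha> x\<close>,
  which is where the formula comes from.\<close>

definition vertex_perm :: "nat \<Rightarrow> (nat \<Rightarrow> nat) \<Rightarrow> nat \<Rightarrow> nat" where
  "vertex_perm n \<alpha> = rot n \<circ> \<alpha>"

lemma vertex_perm_apply: "vertex_perm n \<alpha> x = rot n (\<alpha> x)"
  by (simp add: vertex_perm_def)

lemma vertex_perm_permutes: "matching n \<alpha> \<Longrightarrow> vertex_perm n \<alpha> permutes {..<2 * n}"
  unfolding vertex_perm_def by (intro permutes_compose matchingD rot_permutes)

lemma vertex_perm_permutation: "matching n \<alpha> \<Longrightarrow> permutation (vertex_perm n \<alpha>)"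
  using vertex_perm_permutes permutation_permutes by blast

definition num_vertices :: "nat \<Rightarrow> (nat \<Rightarrow> nat) \<Rightarrow> nat" where
  "num_vertices n \<alpha> = num_cycles {..<2 * n} (vertex_perm n \<alpha>)"

lemma one_vertex_orbit:
  assumes "matching n \<alpha>" "num_vertices n \<alpha> = 1" "x < 2 * n" "y < 2 * n"
  shows "x \<in> orbit (vertex_perm n \<alpha>) y"
  using assms num_cycles_Suc_0_iff[OF vertex_perm_permutes[OF assms(1)]]
  by (auto simp: num_vertices_def)

text \<open>Ends of chords are chosen instead of chords: exchanging \<open>r\<close> for
  \<open>\<alpha> r\<close> gives the other way to re-pair the same two chords, so one operation
  covers both swaps.\<close>

definition swappable :: "nat \<Rightarrow> (nat \<Rightarrow> nat) \<Rightarrow> nat \<Rightarrow> nat \<Rightarrow> bool" where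
  "swappable n \<alpha> p r \<longleftrightarrow> p < 2 * n \<and> r < 2 * n \<and> r \<noteq> p \<and> r \<noteq> \<alpha> p"

text \<open>
  Replaces the chords \<open>{p, \<alpha> p}\<close> and \<open>{r, \<alpha> r}\<close> by \<open>{p, r}\<close> and \<open>{\<alpha> p, \<alpha> r}\<close>; written with
  transpositions so that the effect on the vertex permutation is visible.
\<close>

definition join :: "(nat \<Rightarrow> nat) \<Rightarrow> nat \<Rightarrow> nat \<Rightarrow> nat \<Rightarrow> nat" where
  "join \<alpha> p r = \<alpha> \<circ> transpose p (\<alpha> r) \<circ> transpose r (\<alpha> p)"

lemma swappable_distinct:
  assumes "matching n \<alpha>" "swappable n \<alpha> p r"
  shows "p < 2 * n" "r < 2 * n" "\<alpha> p < 2 * n" "\<alpha> r < 2 * n"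
    "r \<noteq> p" "p \<noteq> r" "r \<noteq> \<alpha> p" "\<alpha> p \<noteq> r" "p \<noteq> \<alpha> r" "\<alpha> r \<noteq> p" "\<alpha> p \<noteq> \<alpha> r" "\<alpha> r \<noteq> \<alpha> p"
    "\<alpha> p \<noteq> p" "p \<noteq> \<alpha> p" "\<alpha> r \<noteq> r" "r \<noteq> \<alpha> r"
proof -
  note m = matchingD[OF assms(1)]
  show 1: "p < 2 * n" "r < 2 * n" "r \<noteq> p" "p \<noteq> r" "r \<noteq> \<alpha> p" "\<alpha> p \<noteq> r"
    using assms(2) by (auto simp: swappable_def)
  show "\<alpha> p < 2 * n" "\<alpha> r < 2 * n" using 1 m(4) by auto
  have "\<alpha> r \<noteq> p" using 1 m(3)[of r] by auto
  then show "p \<noteq> \<alpha> r" "\<alpha> r \<noteq> p" by auto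
  show "\<alpha> p \<noteq> \<alpha> r" "\<alpha> r \<noteq> \<alpha> p" using 1 m(5) by auto
  show "\<alpha> p \<noteq> p" "p \<noteq> \<alpha> p" "\<alpha> r \<noteq> r" "r \<noteq> \<alpha> r" using 1 m(2)[of p] m(2)[of r] by auto
qed

lemma join_apply:
  assumes "matching n \<alpha>" "swappable n \<alpha> p r"
  shows "join \<alpha> p r x =
    (if x = p then r else if x = r then p else if x = \<alpha> p then \<alpha> r else if x = \<alpha> r then \<alpha> p else \<alpha> x)"
proof -
  note [simp] = swappable_distinct[OF assms] matchingD(3,5)[OF assms(1)]
  show ?thesis by (simp add: join_def transpose_def)
qed

lemma join_matching:
  assumes "matching n \<alpha>" "swappable n \<alpha> p r"
  shows "matching n (join \<alpha> p r)"
proof (rule matchingI)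
  fix x
  show "2 * n \<le> x \<Longrightarrow> join \<alpha> p r x = x"
    using swappable_distinct(1-4)[OF assms] matchingD(6)[OF assms(1)] by (auto simp: join_apply[OF assms])
  note [simp] = join_apply[OF assms] swappable_distinct[OF assms] matchingD[OF assms(1)]
  show "x < 2 * n \<Longrightarrow> join \<alpha> p r x < 2 * n" by simp
  show "x < 2 * n \<Longrightarrow> join \<alpha> p r x \<noteq> x" by auto
  show "x < 2 * n \<Longrightarrow> join \<alpha> p r (join \<alpha> p r x) = x" by auto
qed

lemma swappable_commute: "matching n \<alpha> \<Longrightarrow> swappable n \<alpha> p r \<longleftrightarrow> swappable n \<alpha> r p"
  unfolding swappable_def by (metis matchingD(3))

lemma join_commute:
  assumes "matching n \<alpha>" "swappable n \<alpha> p r"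
  shows "join \<alpha> p r = join \<alpha> r p"
  using assms swappable_commute[OF assms(1)] swappable_distinct[OF assms]
  by (auto simp: fun_eq_iff join_apply)

lemma vertex_perm_join:
  "vertex_perm n (join \<alpha> p r) = vertex_perm n \<alpha> \<circ> transpose p (\<alpha> r) \<circ> transpose r (\<alpha> p)"
  by (simp add: vertex_perm_def join_def o_assoc)

text \<open>The two transpositions are disjoint, so either may be applied first. The criteria below
  start with the one on \<open>r\<close> and \<open>\<alpha> p\<close>.\<close>

lemma vertex_perm_join':
  assumes "matching n \<alpha>" "swappable n \<alpha> p r"
  shows "vertex_perm n (join \<alpha> p r) = vertex_perm n \<alpha> \<circ> transpose r (\<alpha> p) \<circ> transpose p (\<alpha> r)"
  unfolding join_commute[OF assms] by (rule vertex_perm_join)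

definition step :: "nat \<Rightarrow> (nat \<Rightarrow> nat) \<Rightarrow> (nat \<Rightarrow> nat) \<Rightarrow> bool" where
  "step n \<alpha> \<beta> \<longleftrightarrow> matching n \<alpha> \<and> num_vertices n \<beta> = num_vertices n \<alpha> \<and>
     (\<exists>p r. swappable n \<alpha> p r \<and> \<beta> = join \<alpha> p r)"

abbreviation reach :: "nat \<Rightarrow> (nat \<Rightarrow> nat) \<Rightarrow> (nat \<Rightarrow> nat) \<Rightarrow> bool" where
  "reach n \<equiv> (step n)\<^sup>*\<^sup>*"

section \<open>Reversibility, invariants, and criteria for a swap to keep the vertex count\<close>

lemma step_sym:
  assumes "step n \<alpha> \<beta>"
  shows "step n \<beta> \<alpha>"
proof -
  obtain p r where 1: "matching n \<alpha>" "swappable n \<alpha> p r" "\<beta> = join \<alpha> p r"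
    using assms by (auto simp: step_def)
  have m: "matching n \<beta>" using join_matching 1 by blast
  note d = swappable_distinct[OF 1(1,2)]
  note j = join_apply[OF 1(1,2)]
  \<comment> \<open>The swap is undone by joining \<open>p\<close> to its former partner.\<close>
  have s: "swappable n \<beta> p (\<alpha> p)" using d by (simp add: swappable_def j 1(3))
  moreover have "\<alpha> = join \<beta> p (\<alpha> p)"
    unfolding fun_eq_iff join_apply[OF m s]
    by (simp add: j 1(3) d matchingD(3,5)[OF 1(1)])
  ultimately show ?thesis using assms m unfolding step_def by auto
qed

lemma reach_sym: "reach n \<alpha> \<beta> \<Longrightarrow> reach n \<beta> \<alpha>"
  using step_sym symp_rtranclp[of "step n"] by (auto simp: symp_def)

lemma reach_step: "reach n \<alpha> \<beta> \<Longrightarrow> step n \<beta> \<gamma> \<Longrightarrow> reach n \<alpha> \<gamma>"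
  by (rule rtranclp.rtrancl_into_rtrancl)

lemma reach_trans: "reach n \<alpha> \<beta> \<Longrightarrow> reach n \<beta> \<gamma> \<Longrightarrow> reach n \<alpha> \<gamma>"
  by (rule rtranclp_trans)

lemma step_matching: "step n \<alpha> \<beta> \<Longrightarrow> matching n \<beta>"
  using join_matching by (auto simp: step_def)

lemma reach_matching:
  assumes "reach n \<alpha> \<beta>" "matching n \<alpha>"
  shows "matching n \<beta>"
  using assms by (induction) (auto dest: step_matching)

lemma reach_num_vertices:
  assumes "reach n \<alpha> \<beta>"
  shows "num_vertices n \<beta> = num_vertices n \<alpha>"
  using assms by induction (auto simp: step_def)

text \<open>The first transposition splits a cycle, the second merges two. The second condition
  refers to the permutation already split, because its two vertices may have been separated only by
  that split.\<close>

lemma step_join_split_merge: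
  assumes "matching n \<alpha>" "swappable n \<alpha> p r"
    and "r \<in> orbit (vertex_perm n \<alpha>) (\<alpha> p)"
    and "\<alpha> r \<notin> orbit (vertex_perm n \<alpha> \<circ> transpose r (\<alpha> p)) p"
  shows "step n \<alpha> (join \<alpha> p r)"
proof -
  let ?f = "vertex_perm n \<alpha>" and ?A = "{..<2 * n}"
  note d = swappable_distinct[OF assms(1,2)]
  have f: "?f permutes ?A" by (rule vertex_perm_permutes) fact
  have pf: "permutation ?f" by (rule vertex_perm_permutation) fact
  have "\<alpha> p \<in> orbit ?f r" using assms(3) by (rule orbit_sym[OF pf])
  then have "num_cycles ?A (?f \<circ> transpose r (\<alpha> p)) = num_cycles ?A ?f + 1"
    using d(1-8) f by (intro num_cycles_split) simp_all
  moreover have "num_cycles ?A (?f \<circ> transpose r (\<alpha> p) \<circ> transpose p (\<alpha> r)) + 1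
      = num_cycles ?A (?f \<circ> transpose r (\<alpha> p))"
    using d(1-4) f assms(4) by (intro num_cycles_merge permutes_compose permutes_swap_id) simp_all
  ultimately show ?thesis
    using assms by (auto simp: step_def num_vertices_def vertex_perm_join')
qed

lemma step_join_merge_split:
  assumes "matching n \<alpha>" "swappable n \<alpha> p r"
    and "r \<notin> orbit (vertex_perm n \<alpha>) (\<alpha> p)"
    and "\<alpha> r \<in> orbit (vertex_perm n \<alpha> \<circ> transpose r (\<alpha> p)) p"
  shows "step n \<alpha> (join \<alpha> p r)"
proof -
  let ?f = "vertex_perm n \<alpha>" and ?A = "{..<2 * n}"
  note d = swappable_distinct[OF assms(1,2)]
  have f: "?f permutes ?A" by (rule vertex_perm_permutes) fact
  have pf: "permutation ?f" by (rule vertex_perm_permutation) fact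
  have "\<alpha> p \<notin> orbit ?f r" using assms(3) orbit_sym[OF pf] by blast
  then have "num_cycles ?A (?f \<circ> transpose r (\<alpha> p)) + 1 = num_cycles ?A ?f"
    using d(1-4) f by (intro num_cycles_merge) simp_all
  moreover have "num_cycles ?A (?f \<circ> transpose r (\<alpha> p) \<circ> transpose p (\<alpha> r))
      = num_cycles ?A (?f \<circ> transpose r (\<alpha> p)) + 1"
    using d(1-4,9) f assms(4) by (intro num_cycles_split permutes_compose permutes_swap_id) simp_all
  ultimately show ?thesis
    using assms by (auto simp: step_def num_vertices_def vertex_perm_join')
qed

text \<open>\<open>rot n u\<close> is the image of \<open>\<alpha> u\<close>, so the first
  transposition always splits: it makes \<open>rot n u\<close> a fixed point, the tip of the leaf.
  Splitting only shrinks orbits, so the merge condition can be checked in the original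
  permutation.\<close>

lemma step_create_leaf:
  assumes "matching n \<alpha>" "u < 2 * n" "\<alpha> u \<noteq> rot n u" "\<alpha> (rot n u) \<notin> orbit (vertex_perm n \<alpha>) u"
  shows "step n \<alpha> (join \<alpha> u (rot n u))" "swappable n \<alpha> u (rot n u)"
proof -
  show s: "swappable n \<alpha> u (rot n u)"
    using assms by (auto simp: swappable_def rot_neq)
  let ?f = "vertex_perm n \<alpha>"
  have "?f (\<alpha> u) = rot n u" using assms by (simp add: vertex_perm_apply matchingD)
  then have 1: "rot n u \<in> orbit ?f (\<alpha> u)" by (metis orbit.base)
  show "step n \<alpha> (join \<alpha> u (rot n u))"
  proof (rule step_join_split_merge[OF assms(1) s 1])
    have pf: "permutation ?f" by (rule vertex_perm_permutation) fact
    have "orbit (?f \<circ> transpose (rot n u) (\<alpha> u)) u \<subseteq> orbit ?f u"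
      using 1 by (intro orbit_transpose_subset pf) (rule orbit_sym[OF pf])
    then show "\<alpha> (rot n u) \<notin> orbit (?f \<circ> transpose (rot n u) (\<alpha> u)) u" using assms(4) by blast
  qed
qed

text \<open>The tip \<open>t\<close> is a fixed point of the vertex permutation, so the criterion
  for making a leaf at \<open>t\<close> is met. The leaf changes places with the side after it,
  whose partner is passed on to \<open>s\<close>.\<close>

lemma step_slide_leaf:
  assumes "matching n \<alpha>" "n \<ge> 2" "s < 2 * n" "\<alpha> s = rot n s"
  defines "t \<equiv> rot n s"
  shows "step n \<alpha> (join \<alpha> t (rot n t))" "swappable n \<alpha> t (rot n t)" "join \<alpha> t (rot n t) t = rot n t"
proof -
  have t: "t < 2 * n" "\<alpha> t = s" using assms by (auto simp: matchingD dest: sym)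
  have "vertex_perm n \<alpha> t = t" using t by (simp add: vertex_perm_apply t_def)
  then have o: "orbit (vertex_perm n \<alpha>) t = {t}" by (simp add: orbit_eq_singleton_iff)
  have "\<alpha> t \<noteq> rot n t" using t rot_neq(2)[OF assms(3,2)] by (simp add: t_def)
  moreover from this have "\<alpha> (rot n t) \<noteq> t" using matchingD(3)[OF assms(1), of "rot n t"] by auto
  ultimately show "step n \<alpha> (join \<alpha> t (rot n t))" and s: "swappable n \<alpha> t (rot n t)"
    using step_create_leaf[OF assms(1) t(1)] o by auto
  show "join \<alpha> t (rot n t) t = rot n t" by (simp add: join_apply[OF assms(1) s])
qed

lemma reach_leaf_at:
  assumes "matching n \<alpha>" "n \<ge> 2" "s < 2 * n" "\<alpha> s = rot n s" "t < 2 * n"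
  obtains \<beta> where "reach n \<alpha> \<beta>" "\<beta> t = rot n t"
proof -
  have "\<exists>\<beta>. reach n \<alpha> \<beta> \<and> \<beta> ((rot n ^^ k) s) = rot n ((rot n ^^ k) s)" for k
  proof (induction k)
    case 0
    show ?case using assms by auto
  next
    case (Suc k)
    then obtain \<beta> where b: "reach n \<alpha> \<beta>" "\<beta> ((rot n ^^ k) s) = rot n ((rot n ^^ k) s)" by blast
    have lt: "(rot n ^^ k) s < 2 * n" using assms by (simp add: rot_funpow)
    note sl = step_slide_leaf[OF reach_matching[OF b(1) assms(1)] assms(2) lt b(2)]
    show ?case
      unfolding funpow.simps o_apply
      using reach_step[OF b(1) sl(1)] sl(3) by blast
  qed
  then show thesis using that rot_transitive[OF assms(3,5)] by metis
qed

section \<open>Creating a leaf\<close>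

lemma rot_parity: "x < 2 * n \<Longrightarrow> even (rot n x) \<longleftrightarrow> odd x"
  by (auto simp: rot_eq dest: arg_cong[where f = even])

text \<open>In this situation vertex identification is at least as coarse as parity.\<close>

definition alternating :: "nat \<Rightarrow> (nat \<Rightarrow> nat) \<Rightarrow> bool" where
  "alternating n \<alpha> \<longleftrightarrow> (\<forall>u<2 * n. \<alpha> (rot n u) \<in> orbit (vertex_perm n \<alpha>) u)"

text \<open>Each vertex lies in the class of the vertex two places before it, since
  \<open>rot n (rot n u)\<close> is the image of \<open>\<alpha> (rot n u)\<close>.\<close>

lemma alternating_orbits:
  assumes "matching n \<alpha>" "alternating n \<alpha>" "x < 2 * n"
  shows "x \<in> orbit (vertex_perm n \<alpha>) (x mod 2)"
  using assms(3)
proof (induction x rule: less_induct)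
  case (less x)
  let ?f = "vertex_perm n \<alpha>"
  have pf: "permutation ?f" by (rule vertex_perm_permutation) fact
  show ?case
  proof (cases "x < 2")
    case True
    then show ?thesis using permutation_self_in_orbit[OF pf] by simp
  next
    case False
    define u where "u = x - 2"
    have u: "u < 2 * n" "x = rot n (rot n u)" "u < x" "u mod 2 = x mod 2"
      using False less.prems by (auto simp: u_def rot_eq mod2_eq_if)
    have "?f (\<alpha> (rot n u)) = x" using u assms by (simp add: vertex_perm_apply matchingD)
    moreover have "\<alpha> (rot n u) \<in> orbit ?f u" using assms u by (simp add: alternating_def)
    ultimately have "x \<in> orbit ?f u" by (metis orbit.step)
    moreover have "u \<in> orbit ?f (x mod 2)" using less.IH[OF u(3,1)] u(4) by simp
    ultimately show ?thesis by (rule orbit_trans)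
  qed
qed

lemma alternating_0_1:
  assumes "matching n \<alpha>" "alternating n \<alpha>" "n \<ge> 1" "num_vertices n \<alpha> \<noteq> 1"
  shows "0 \<notin> orbit (vertex_perm n \<alpha>) 1"
proof
  let ?f = "vertex_perm n \<alpha>"
  assume 01: "0 \<in> orbit ?f 1"
  have pf: "permutation ?f" by (rule vertex_perm_permutation) fact
  have o1: "x \<in> orbit ?f 1" if "x < 2 * n" for x
  proof (cases "even x")
    case True
    then have "x \<in> orbit ?f 0" using alternating_orbits[OF assms(1,2) that] by simp
    then show ?thesis using 01 by (rule orbit_trans)
  next
    case False
    then have "x mod 2 = 1" by presburger
    then show ?thesis using alternating_orbits[OF assms(1,2) that] by simp
  qed
  have "\<forall>x\<in>{..<2 * n}. \<forall>y\<in>{..<2 * n}. x \<in> orbit ?f y"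
    using o1 orbit_sym[OF pf] orbit_trans by (metis lessThan_iff)
  then have "num_vertices n \<alpha> = 1"
    using num_cycles_Suc_0_iff[OF vertex_perm_permutes[OF assms(1)]] assms(3)
    by (simp add: num_vertices_def lessThan_empty_iff)
  then show False using assms(4) by simp
qed

text \<open>A chord between sides of equal parity would send \<open>x\<close> to a vertex of the
  other parity, and the two parity classes would become one.\<close>

lemma alternating_parity:
  assumes "matching n \<alpha>" "alternating n \<alpha>" "num_vertices n \<alpha> \<noteq> 1" "x < 2 * n"
  shows "even (\<alpha> x) \<longleftrightarrow> odd x"
proof (rule ccontr)
  assume *: "\<not> ?thesis"
  let ?f = "vertex_perm n \<alpha>"
  have pf: "permutation ?f" by (rule vertex_perm_permutation) fact
  have lt: "?f x < 2 * n" "\<alpha> x < 2 * n" using assms by (simp_all add: vertex_perm_apply matchingD)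
  have par: "even (?f x) \<longleftrightarrow> odd x" using * rot_parity[OF lt(2)] by (simp add: vertex_perm_apply)
  have 1: "?f x \<in> orbit ?f (?f x mod 2)" "x \<in> orbit ?f (x mod 2)"
    using alternating_orbits assms lt by blast+
  have "?f x mod 2 \<in> orbit ?f (?f x)" using 1(1) by (rule orbit_sym[OF pf])
  moreover have "?f x \<in> orbit ?f (x mod 2)" using 1(2) by (rule orbit.step)
  ultimately have "?f x mod 2 \<in> orbit ?f (x mod 2)" by (rule orbit_trans)
  moreover have "?f x mod 2 = 0 \<and> x mod 2 = 1 \<or> ?f x mod 2 = 1 \<and> x mod 2 = 0"
    using par by presburger
  ultimately have "0 \<in> orbit ?f 1"
    using orbit_sym[OF pf] by auto
  then show False using alternating_0_1[OF assms(1,2)] assms(3,4) by auto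
qed

lemma not_alternating_leaf:
  assumes "matching n \<alpha>" "n \<ge> 2" "\<not> alternating n \<alpha>"
  obtains \<beta> u where "reach n \<alpha> \<beta>" "u < 2 * n" "\<beta> u = rot n u"
proof -
  obtain u where u: "u < 2 * n" "\<alpha> (rot n u) \<notin> orbit (vertex_perm n \<alpha>) u"
    using assms(3) by (auto simp: alternating_def)
  show thesis
  proof (cases "\<alpha> u = rot n u")
    case True
    then show ?thesis using u that by blast
  next
    case False
    note st = step_create_leaf[OF assms(1) u(1) False u(2)]
    have "join \<alpha> u (rot n u) u = rot n u" by (simp add: join_apply[OF assms(1) st(2)])
    moreover have "reach n \<alpha> (join \<alpha> u (rot n u))" using st(1) by blast
    ultimately show ?thesis using u(1) that by blast
  qed
qed

text \<open>When no leaf can be made at once, the diagram is alternating and all its chords join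
  sides of opposite parity. A swap that creates the chord from 0 to the even side
  \<open>\<alpha> 1\<close> destroys this, so that afterwards some leaf can be made.\<close>

lemma exists_leaf:
  assumes "matching n \<alpha>" "n \<ge> 2" "num_vertices n \<alpha> \<noteq> 1"
  obtains \<beta> u where "reach n \<alpha> \<beta>" "u < 2 * n" "\<beta> u = rot n u"
proof (cases "alternating n \<alpha> \<and> \<alpha> 0 \<noteq> rot n 0")
  case False
  then show ?thesis
    using not_alternating_leaf[OF assms(1,2)] that assms(2) by (cases "\<alpha> 0 = rot n 0") force+
next
  case True
  let ?f = "vertex_perm n \<alpha>"
  let ?g = "?f \<circ> transpose 0 1"
  let ?b = "\<alpha> 1"
  have pf: "permutation ?f" by (rule vertex_perm_permutation) fact
  have pg: "permutation ?g" by (rule permutation_transpose_comp) fact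
  have n: "0 < 2 * n" "1 < 2 * n" using assms(2) by auto
  have \<alpha>0: "\<alpha> 0 \<noteq> 1" using True n by (simp add: rot_eq)
  then have \<alpha>1: "?b \<noteq> 0" using matchingD(3)[OF assms(1), of 1] by metis
  have sw: "swappable n \<alpha> ?b 0"
    using n \<alpha>1 assms(1) by (simp add: swappable_def matchingD)
  have 01: "0 \<notin> orbit ?f 1" using alternating_0_1 True assms by simp
  then have 10: "1 \<notin> orbit ?f 0" using orbit_sym[OF pf] by blast
  have g01: "1 \<in> orbit ?g 0" by (rule orbit_transpose_merge[OF pf 10])
  \<comment> \<open>Once 0 and 1 have been merged all vertices lie in one cycle, so the second
    transposition is bound to split.\<close>
  have all: "x \<in> orbit ?g 0" if "x < 2 * n" for x
  proof -
    have "x \<in> orbit ?g (x mod 2)"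
      using orbit_transpose_superset[OF pf 10, of "x mod 2"] alternating_orbits[OF assms(1) _ that] True
      by blast
    moreover have "x mod 2 = 0 \<or> x mod 2 = 1" by presburger
    ultimately show ?thesis using g01 orbit_trans by metis
  qed
  have "\<alpha> 0 \<in> orbit ?g ?b"
    using all[of "\<alpha> 0"] all[of ?b] n assms(1) orbit_sym[OF pg] orbit_trans by (metis matchingD(4))
  then have st: "step n \<alpha> (join \<alpha> ?b 0)"
    using 01 by (intro step_join_merge_split[OF assms(1) sw]) (simp_all add: matchingD(3)[OF assms(1)])
  let ?\<beta> = "join \<alpha> ?b 0"
  have mb: "matching n ?\<beta>" using st by (rule step_matching)
  have "?\<beta> 0 = ?b" using \<alpha>1 unfolding join_apply[OF assms(1) sw] by simp
  moreover have "even ?b" using alternating_parity[OF assms(1) _ assms(3) n(2)] True by simp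
  moreover have "num_vertices n ?\<beta> \<noteq> 1" using st assms(3) by (simp add: step_def)
  ultimately have "\<not> alternating n ?\<beta>"
    using alternating_parity[OF mb _ _ n(1)] by auto
  then obtain \<gamma> u where "reach n ?\<beta> \<gamma>" "u < 2 * n" "\<gamma> u = rot n u"
    using not_alternating_leaf[OF mb assms(2)] by blast
  then show ?thesis
    using that converse_rtranclp_into_rtranclp[of "step n", OF st] by blast
qed

section \<open>Handles in one-vertex diagrams\<close>

text \<open>The tip of a leaf is a fixed point of the vertex permutation, hence a second
  vertex.\<close>

lemma one_vertex_no_leaf:
  assumes "matching n \<alpha>" "num_vertices n \<alpha> = 1" "n \<ge> 1" "u < 2 * n"
  shows "\<alpha> u \<noteq> rot n u" "\<alpha> (rot n u) \<noteq> u"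
proof -
  show "\<alpha> (rot n u) \<noteq> u"
  proof
    assume "\<alpha> (rot n u) = u"
    then have "vertex_perm n \<alpha> (rot n u) = rot n u" by (simp add: vertex_perm_apply)
    then have "orbit (vertex_perm n \<alpha>) (rot n u) = {rot n u}" by (simp add: orbit_eq_singleton_iff)
    then show False
      using one_vertex_orbit[OF assms(1,2,4), of "rot n u"] assms(4) rot_neq(1)[OF assms(4)] by simp
  qed
  then show "\<alpha> u \<noteq> rot n u" using matchingD(3)[OF assms(1), of u] by auto
qed

text \<open>
  The chord of the middle side \<open>s\<close> is cut out first: without it there are two vertices, and the
  two swapped chords are analysed in that smaller diagram.
\<close>

lemma step_join_around:
  assumes m: "matching n \<alpha>" "num_vertices n \<alpha> = 1" and n: "n \<ge> 2" and p: "p < 2 * n"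
  defines "s \<equiv> rot n p"
  defines "r \<equiv> rot n s"
  assumes pr: "\<alpha> p \<noteq> r"
    and "\<alpha> r \<notin> orbit (vertex_perm n \<alpha> \<circ> transpose s (\<alpha> s)) p"
  shows "step n \<alpha> (join \<alpha> p r)" "swappable n \<alpha> p r"
proof -
  let ?f = "vertex_perm n \<alpha>" and ?A = "{..<2 * n}"
  \<comment> \<open>Multiplying by this transposition unglues \<open>s\<close> and
    \<open>\<alpha> s\<close>: it gives the permutation that belongs to the involution fixing both
    sides.\<close>
  let ?f1 = "?f \<circ> transpose s (\<alpha> s)"
  let ?f2 = "?f1 \<circ> transpose p (\<alpha> r)"
  let ?f3 = "?f2 \<circ> transpose r (\<alpha> p)"
  have lt: "s < 2 * n" "r < 2 * n" "\<alpha> s < 2 * n" "\<alpha> p < 2 * n" "\<alpha> r < 2 * n"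
    using p by (simp_all add: s_def r_def matchingD[OF m(1)])
  have ne: "r \<noteq> p" "s \<noteq> p" "r \<noteq> s" using rot_neq[OF p] rot_neq[OF lt(1)] n by (simp_all add: s_def r_def)
  have n1: "n \<ge> 1" using n by simp
  have lf: "\<alpha> p \<noteq> s" "\<alpha> s \<noteq> p" "\<alpha> s \<noteq> r" "\<alpha> r \<noteq> s"
    using one_vertex_no_leaf[OF m n1 p] one_vertex_no_leaf[OF m n1 lt(1)] by (simp_all add: s_def r_def)
  show sw: "swappable n \<alpha> p r" using p lt ne pr by (simp add: swappable_def)
  note d = swappable_distinct[OF m(1) sw]
  have d2: "\<alpha> p \<noteq> \<alpha> s" "\<alpha> r \<noteq> \<alpha> s" "\<alpha> s \<noteq> s" using ne lt matchingD[OF m(1)] by auto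
  note D = ne ne[symmetric] lf lf[symmetric] d d2 d2[symmetric]
  have f: "?f permutes ?A" by (rule vertex_perm_permutes) fact
  have f1: "?f1 permutes ?A" and f2: "?f2 permutes ?A" and f3: "?f3 permutes ?A"
    using f lt p by (intro permutes_compose permutes_swap_id; simp)+
  have "num_cycles ?A ?f1 = num_cycles ?A ?f + 1"
    using f lt D(20-) one_vertex_orbit[OF m] by (intro num_cycles_split) simp_all
  moreover have "num_cycles ?A ?f2 + 1 = num_cycles ?A ?f1"
    using f1 lt p assms(8) by (intro num_cycles_merge) simp_all
  ultimately have c2: "num_cycles ?A ?f2 = 1" using m(2) by (simp add: num_vertices_def)
  have "\<alpha> p \<in> orbit ?f2 r"
    using c2 num_cycles_Suc_0_iff[OF f2] lt p by auto
  then have c3: "num_cycles ?A ?f3 = num_cycles ?A ?f2 + 1"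
    using f2 lt D by (intro num_cycles_split) simp_all
  \<comment> \<open>With \<open>s\<close> unglued and \<open>p\<close> joined to \<open>r\<close>,
    the two ends of the side \<open>s\<close> form a cycle by themselves, so gluing \<open>s\<close>
    back merges.\<close>
  have "?f3 s = r" using D by (simp add: vertex_perm_apply matchingD(3)[OF m(1)] r_def)
  moreover have "?f3 r = s" using D by (simp add: vertex_perm_apply matchingD(3)[OF m(1)] s_def)
  ultimately have "orbit ?f3 s \<subseteq> {s, r}" by (intro orbit_subset_closed) auto
  then have "\<alpha> s \<notin> orbit ?f3 s" using D by auto
  then have c4: "num_cycles ?A (?f3 \<circ> transpose s (\<alpha> s)) + 1 = num_cycles ?A ?f3"
    using f3 lt by (intro num_cycles_merge) simp_all
  \<comment> \<open>The transposition of \<open>s\<close> and \<open>\<alpha> s\<close> is disjoint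
    from the other two, so its two occurrences cancel.\<close>
  have "?f3 \<circ> transpose s (\<alpha> s) = vertex_perm n (join \<alpha> p r)"
    unfolding vertex_perm_join fun_eq_iff using D by (simp add: transpose_def)
  then have "num_vertices n (join \<alpha> p r) = 1" using c2 c3 c4 by (simp add: num_vertices_def)
  then show "step n \<alpha> (join \<alpha> p r)" using m sw by (auto simp: step_def)
qed

text \<open>Let \<open>t = rot n c\<close>. Since \<open>c\<close> lies alone under the chord from
  \<open>s\<close> to \<open>t\<close>, the vertex permutation runs \<open>\<alpha> c\<close>,
  \<open>t\<close>, \<open>c\<close>, \<open>d\<close>. The first transposition cuts off the cycle
  of \<open>t\<close>, \<open>c\<close>, \<open>d\<close>, and \<open>\<alpha> d\<close> lies
  outside it. The far end of the chord of \<open>c\<close> moves one side forward.\<close>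

lemma step_slide_far_end:
  assumes m: "matching n \<alpha>" and "s < 2 * n" "\<alpha> s = rot n (rot n s)"
  defines "c \<equiv> rot n s"
  defines "d \<equiv> rot n (\<alpha> c)"
  assumes "d \<noteq> s"
  shows "step n \<alpha> (join \<alpha> c d)" "swappable n \<alpha> c d" "join \<alpha> c d c = d"
    and "join \<alpha> c d s = \<alpha> s"
proof -
  let ?f = "vertex_perm n \<alpha>"
  define t where "t = rot n c"
  have lt: "c < 2 * n" "d < 2 * n" "t < 2 * n"
    using assms by (simp_all add: matchingD c_def d_def t_def)
  have ts: "\<alpha> s = t" "\<alpha> t = s" using assms matchingD(3)[OF m, of s] by (simp_all add: t_def c_def)
  have cs: "c \<noteq> s" "t \<noteq> c" "s \<noteq> t"
    using rot_neq(1)[OF assms(2)] rot_neq(1)[OF lt(1)] matchingD(2)[OF m assms(2)] ts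
    by (simp_all add: c_def t_def)
  have bs: "\<alpha> c \<noteq> s" "\<alpha> c \<noteq> t" "\<alpha> c \<noteq> c"
    using ts cs matchingD(2,3)[OF m, of c] lt by auto
  have dd: "d \<noteq> c" "d \<noteq> t" "d \<noteq> \<alpha> c"
    using bs rot_inj[of n] rot_neq(1)[of "\<alpha> c" n] lt matchingD(4)[OF m] by (auto simp: d_def c_def t_def)
  have ad: "\<alpha> d \<noteq> d" "\<alpha> d \<noteq> c" "\<alpha> d \<noteq> t" "\<alpha> d \<noteq> s"
    using dd assms(6) ts matchingD(2,3)[OF m, of d] lt by auto
  show sw: "swappable n \<alpha> c d" using lt dd by (simp add: swappable_def)
  have f: "?f (\<alpha> c) = t" "?f t = c" "?f c = d"
    by (simp_all add: vertex_perm_apply matchingD(3)[OF m] t_def d_def c_def ts(2)[unfolded t_def c_def])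
  have 1: "d \<in> orbit ?f (\<alpha> c)" using orbit.base[of ?f "\<alpha> c"] orbit.step[of _ ?f "\<alpha> c"] f by metis
  have "orbit (?f \<circ> transpose d (\<alpha> c)) c \<subseteq> {c, d, t}"
    by (rule orbit_subset_closed) (auto simp: f dd bs cs dd[symmetric] bs[symmetric] cs[symmetric])
  then have "\<alpha> d \<notin> orbit (?f \<circ> transpose d (\<alpha> c)) c" using ad by blast
  then show "step n \<alpha> (join \<alpha> c d)" using 1 by (intro step_join_split_merge[OF m sw])
  show "join \<alpha> c d c = d" "join \<alpha> c d s = \<alpha> s"
    using cs bs assms(6) ad by (auto simp: join_apply[OF m sw])
qed

definition handle :: "nat \<Rightarrow> (nat \<Rightarrow> nat) \<Rightarrow> nat \<Rightarrow> bool" where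
  "handle n \<alpha> s \<longleftrightarrow> \<alpha> s = rot n (rot n s) \<and> \<alpha> (rot n s) = rot n (rot n (rot n s))"

lemma rot_distinct:
  assumes "x < 2 * n" "n \<ge> 3"
  shows "distinct [x, rot n x, rot n (rot n x), rot n (rot n (rot n x)), rot n (rot n (rot n (rot n x)))]"
  using assms rot_neq[of x n] rot_neq[of "rot n x" n] rot_neq[of "rot n (rot n x)" n]
    rot_neq[of "rot n (rot n (rot n x))" n]
  by auto

text \<open>Along a handle the vertex permutation runs s, s + 3, s + 2, s + 1, s + 4 (cyclically),
  so the first transposition cuts off all of these but s. The side jumped over, four places after s,
  passes its partner on to s.\<close>

lemma step_slide_handle:
  assumes m: "matching n \<alpha>" and n: "n \<ge> 3" and s: "s < 2 * n" and h: "handle n \<alpha> s"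
  defines "p \<equiv> rot n (rot n s)"
  defines "r \<equiv> rot n (rot n p)"
  shows "step n \<alpha> (join \<alpha> p r)" "swappable n \<alpha> p r" "handle n (join \<alpha> p r) (rot n s)"
    "join \<alpha> p r s = \<alpha> r"
proof -
  let ?f = "vertex_perm n \<alpha>"
  define s1 where "s1 = rot n s"
  define s3 where "s3 = rot n p"
  have dist: "distinct [s, s1, p, s3, r]"
    using rot_distinct[OF s n] by (simp add: s1_def s3_def p_def r_def)
  have lt: "s1 < 2 * n" "p < 2 * n" "s3 < 2 * n" "r < 2 * n"
    using s by (simp_all add: s1_def s3_def p_def r_def)
  have a: "\<alpha> s = p" "\<alpha> s1 = s3" "\<alpha> p = s" "\<alpha> s3 = s1"
    using h matchingD(3)[OF m, of s] matchingD(3)[OF m, of s1]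
    by (simp_all add: handle_def s1_def s3_def p_def)
  have "\<alpha> r \<noteq> r" using matchingD(2)[OF m lt(4)] .
  moreover have "\<alpha> r \<noteq> x" if "x \<in> {s, s1, p, s3}" for x
    using that dist a matchingD(3)[OF m, of r] by auto
  ultimately have ar: "\<alpha> r \<noteq> r" "\<alpha> r \<noteq> s" "\<alpha> r \<noteq> s1" "\<alpha> r \<noteq> p" "\<alpha> r \<noteq> s3" by auto
  show sw: "swappable n \<alpha> p r" using lt dist a by (auto simp: swappable_def)
  have f: "?f s = s3" "?f s3 = p" "?f p = s1" "?f s1 = r"
    by (simp_all add: vertex_perm_apply a) (simp_all add: s1_def s3_def p_def r_def)
  have 1: "r \<in> orbit ?f (\<alpha> p)" unfolding a using f by (metis orbit.base orbit.step)
  have "orbit (?f \<circ> transpose r (\<alpha> p)) p \<subseteq> {s1, p, s3, r}"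
    by (rule orbit_subset_closed) (use f a dist in auto)
  then have "\<alpha> r \<notin> orbit (?f \<circ> transpose r (\<alpha> p)) p" using ar by blast
  then show "step n \<alpha> (join \<alpha> p r)" using 1 by (intro step_join_split_merge[OF m sw])
  have j: "join \<alpha> p r s = \<alpha> r" "join \<alpha> p r p = r" "join \<alpha> p r s1 = s3"
    using dist a ar by (auto simp: join_apply[OF m sw])
  show "join \<alpha> p r s = \<alpha> r" by (rule j)
  show "handle n (join \<alpha> p r) (rot n s)"
    unfolding handle_def using j by (simp add: s1_def s3_def p_def r_def)
qed

lemma reach_handle_at:
  assumes "matching n \<alpha>" "n \<ge> 3" "s < 2 * n" "handle n \<alpha> s" "t < 2 * n"
  obtains \<beta> where "reach n \<alpha> \<beta>" "handle n \<beta> t"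
proof -
  have "\<exists>\<beta>. reach n \<alpha> \<beta> \<and> handle n \<beta> ((rot n ^^ k) s)" for k
  proof (induction k)
    case 0
    show ?case using assms by auto
  next
    case (Suc k)
    then obtain \<beta> where b: "reach n \<alpha> \<beta>" "handle n \<beta> ((rot n ^^ k) s)" by blast
    have lt: "(rot n ^^ k) s < 2 * n" using assms by (simp add: rot_funpow)
    note sl = step_slide_handle[OF reach_matching[OF b(1) assms(1)] assms(2) lt b(2)]
    show ?case
      unfolding funpow.simps o_apply
      using reach_step[OF b(1) sl(1)] sl(3) by blast
  qed
  then show thesis using that rot_transitive[OF assms(3,5)] by metis
qed

text \<open>The far end of the chord of the enclosed side is slid forward at most \<open>k\<close>
  times, until it stands just before \<open>s\<close>; this completes the four sides of a handle.
  The last clause records that chords which the far end does not pass over are untouched;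
  \<open>bolza_handle_escape\<close> needs it to keep track of a second chord.\<close>

lemma reach_handle_from_short_chord:
  assumes "matching n \<alpha>" "s < 2 * n" "\<alpha> s = rot n (rot n s)"
    and "(rot n ^^ k) (rot n (\<alpha> (rot n s))) = s"
  shows "\<exists>\<beta> t. reach n \<alpha> \<beta> \<and> t < 2 * n \<and> rot n t = s \<and> handle n \<beta> t \<and>
    (\<forall>u. u \<noteq> rot n s \<and> u \<noteq> \<alpha> (rot n s) \<and>
        (\<forall>i<k. u \<noteq> (rot n ^^ i) (rot n (\<alpha> (rot n s))) \<and> \<alpha> u \<noteq> (rot n ^^ i) (rot n (\<alpha> (rot n s)))) \<longrightarrow>
      \<beta> u = \<alpha> u)"
  using assms(1,3,4)
proof (induction k arbitrary: \<alpha>)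
  case (0 \<alpha>)
  let ?b = "\<alpha> (rot n s)"
  have "?b < 2 * n" using 0 assms(2) by (simp add: matchingD)
  moreover have "rot n ?b = s" using 0 by simp
  moreover have "handle n \<alpha> ?b"
    using 0 by (simp add: handle_def matchingD(3) \<open>rot n ?b = s\<close>)
  ultimately show ?case by blast
next
  case (Suc k \<alpha>)
  let ?c = "rot n s"
  let ?b = "\<alpha> ?c"
  let ?d = "rot n ?b"
  show ?case
  proof (cases "?d = s")
    \<comment> \<open>\<open>k\<close> need not be minimal, so the far end may arrive with slides to
      spare; sliding over \<open>s\<close> itself is not possible.\<close>
    case True
    have "?b < 2 * n" using Suc.prems assms(2) by (simp add: matchingD)
    moreover have "handle n \<alpha> ?b"
      using Suc.prems by (simp add: handle_def matchingD(3) True)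
    ultimately show ?thesis using True by blast
  next
    case False
    note sl = step_slide_far_end[OF Suc.prems(1) assms(2) Suc.prems(2) False]
    let ?\<alpha>' = "join \<alpha> ?c ?d"
    have m': "matching n ?\<alpha>'" using sl(1) by (rule step_matching)
    have "(rot n ^^ k) (rot n (?\<alpha>' ?c)) = s"
      using Suc.prems(3) by (simp add: sl(3) funpow_swap1)
    then obtain \<beta> t where bt: "reach n ?\<alpha>' \<beta>" "t < 2 * n" "rot n t = s" "handle n \<beta> t"
      and *: "\<forall>u. u \<noteq> ?c \<and> u \<noteq> ?\<alpha>' ?c \<and>
        (\<forall>i<k. u \<noteq> (rot n ^^ i) (rot n (?\<alpha>' ?c)) \<and> ?\<alpha>' u \<noteq> (rot n ^^ i) (rot n (?\<alpha>' ?c))) \<longrightarrow>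
      \<beta> u = ?\<alpha>' u"
      using Suc.IH[OF m' trans[OF sl(4) Suc.prems(2)]] by blast
    have "\<beta> u = \<alpha> u" if u: "u \<noteq> ?c" "u \<noteq> ?b"
      "\<forall>i<Suc k. u \<noteq> (rot n ^^ i) ?d \<and> \<alpha> u \<noteq> (rot n ^^ i) ?d" for u
    proof -
      have "u \<noteq> ?d" "\<alpha> u \<noteq> ?d" using u(3) by force+
      then have eq: "?\<alpha>' u = \<alpha> u"
        using u(1,2) matchingD(3)[OF Suc.prems(1), of ?d]
        by (auto simp: join_apply[OF Suc.prems(1) sl(2)] matchingD(3)[OF Suc.prems(1)])
      have "u \<noteq> (rot n ^^ i) (rot n ?d) \<and> \<alpha> u \<noteq> (rot n ^^ i) (rot n ?d)" if "i < k" for i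
        using u(3)[rule_format, of "Suc i"] that by (simp add: funpow_swap1)
      then show ?thesis using * u(1) \<open>u \<noteq> ?d\<close> by (simp add: eq sl(3))
    qed
    moreover have "reach n \<alpha> \<beta>"
      using sl(1) bt(1) by (rule converse_rtranclp_into_rtranclp)
    ultimately show ?thesis using bt by blast
  qed
qed

section \<open>The cyclic order at a single vertex\<close>

definition bolza_map :: "nat \<Rightarrow> nat \<Rightarrow> nat" where
  "bolza_map n x = (if x < 2 * n then (x + n) mod (2 * n) else x)"

lemma funpow_full_cycle:
  assumes "\<And>x. x \<in> A \<Longrightarrow> x \<in> orbit f a" "orbit f a \<subseteq> A" "a \<in> A"
  shows "(f ^^ card A) a = a" "inj_on (\<lambda>k. (f ^^ k) a) {..<card A}" "A = (\<lambda>k. (f ^^ k) a) ` {..<card A}"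
proof -
  have self: "a \<in> orbit f a" using assms by simp
  have eq: "A = (\<lambda>k. (f ^^ k) a) ` {0..<funpow_dist1 f a a}"
    using assms orbit_conv_funpow_dist1[OF self] by auto
  have inj: "inj_on (\<lambda>k. (f ^^ k) a) {0..<funpow_dist1 f a a}"
    by (rule inj_on_funpow_dist1) fact
  have "card A = funpow_dist1 f a a"
    by (subst eq, subst card_image[OF inj]) simp
  then show "(f ^^ card A) a = a" "inj_on (\<lambda>k. (f ^^ k) a) {..<card A}"
      "A = (\<lambda>k. (f ^^ k) a) ` {..<card A}"
    using funpow_dist1_prop[OF self] inj eq by (simp_all add: atLeast0LessThan)
qed

locale one_vertex =
  fixes n :: nat and \<alpha> :: "nat \<Rightarrow> nat"
  assumes m: "matching n \<alpha>" and one: "num_vertices n \<alpha> = 1" and n: "n \<ge> 1"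
begin

text \<open>Times are not reduced modulo 2n, so that cyclic order becomes the order of
  \<open>nat\<close> within windows of length 2n.\<close>

definition U :: "nat \<Rightarrow> nat" where
  "U k = (vertex_perm n \<alpha> ^^ k) 0"

lemma U_Suc: "U (Suc k) = rot n (\<alpha> (U k))"
  by (simp add: U_def vertex_perm_apply)

lemma U_cycle:
  shows "(vertex_perm n \<alpha> ^^ (2 * n)) 0 = 0" "inj_on U {..<2 * n}" "{..<2 * n} = U ` {..<2 * n}"
proof -
  let ?f = "vertex_perm n \<alpha>" and ?A = "{..<2 * n}"
  have "0 \<in> ?A" using n by simp
  moreover have "x \<in> orbit ?f 0" if "x \<in> ?A" for x
    using one_vertex_orbit[OF m one] that n by simp
  moreover have "orbit ?f 0 \<subseteq> ?A"
    using permutes_orbit_subset[OF vertex_perm_permutes[OF m]] n by simp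
  ultimately show "(?f ^^ (2 * n)) 0 = 0" "inj_on U ?A" "?A = U ` ?A"
    using funpow_full_cycle[of ?A ?f 0] unfolding U_def by simp_all
qed

lemma U_mod: "U (k mod (2 * n)) = U k"
  unfolding U_def by (rule funpow_mod_eq[OF U_cycle(1)])

lemma U_eq_iff: "U i = U j \<longleftrightarrow> i mod (2 * n) = j mod (2 * n)"
proof
  assume "U i = U j"
  then have "U (i mod (2 * n)) = U (j mod (2 * n))" by (simp add: U_mod)
  then show "i mod (2 * n) = j mod (2 * n)"
    using U_cycle(2) n by (auto dest: inj_onD)
qed (metis U_mod)

lemma U_less: "U k < 2 * n"
proof -
  have "k mod (2 * n) \<in> {..<2 * n}" using n by simp
  then have "U (k mod (2 * n)) \<in> {..<2 * n}" by (subst U_cycle(3)) (rule imageI)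
  then show ?thesis by (simp add: U_mod)
qed

lemma U_surj:
  assumes "x < 2 * n"
  obtains k where "U k = x"
  using assms U_cycle(3) by (metis imageE lessThan_iff)

lemma U_window:
  assumes "U i = U j" "k \<le> i" "i < k + 2 * n" "k \<le> j" "j < k + 2 * n"
  shows "i = j"
proof -
  have "x = y" if "x mod (2 * n) = y mod (2 * n)" "x \<le> y" "y < x + 2 * n" for x y
  proof -
    have "2 * n dvd y - x" using that mod_eq_dvd_iff_nat[of x y "2 * n"] by metis
    then show ?thesis using that(2,3) dvd_imp_le[of "2 * n" "y - x"] by (cases "y = x") auto
  qed
  from this[of i j] this[of j i] show ?thesis using assms by (cases "i \<le> j") (auto simp: U_eq_iff)
qed

text \<open>
  Travelling around the single vertex, \<open>partner k\<close> is the next time after \<open>k\<close> at which the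
  chord of the side \<open>U k\<close> is met again.
\<close>

definition partner :: "nat \<Rightarrow> nat" where
  "partner k = (SOME j. k < j \<and> j < k + 2 * n \<and> U j = \<alpha> (U k))"

lemma partner: "k < partner k" "partner k < k + 2 * n" "U (partner k) = \<alpha> (U k)"
proof -
  obtain i where i: "U i = \<alpha> (U k)"
    using U_surj U_less matchingD(4)[OF m] by metis
  \<comment> \<open>\<open>(2 * n - 1) * k\<close> stands for the negative of \<open>k\<close>
    modulo \<open>2 * n\<close>; thus \<open>j\<close> is the first time from \<open>k\<close> on
    that is congruent to \<open>i\<close>.\<close>
  define j where "j = k + (i + (2 * n - 1) * k) mod (2 * n)"
  have "j mod (2 * n) = (k + (i + (2 * n - 1) * k)) mod (2 * n)"
    by (simp add: j_def mod_add_right_eq)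
  also have "k + (i + (2 * n - 1) * k) = i + 2 * n * k"
    using n by (cases n) (simp_all add: algebra_simps)
  finally have "U j = \<alpha> (U k)" using i by (simp add: U_eq_iff flip: i)
  moreover have "j < k + 2 * n" using n by (simp add: j_def)
  moreover have "j \<noteq> k" using calculation matchingD(2)[OF m U_less[of k]] by metis
  moreover have "k \<le> j" by (simp add: j_def)
  ultimately have "\<exists>j. k < j \<and> j < k + 2 * n \<and> U j = \<alpha> (U k)" by (intro exI[of _ j]) simp
  then have "k < partner k \<and> partner k < k + 2 * n \<and> U (partner k) = \<alpha> (U k)"
    unfolding partner_def by (rule someI_ex)
  then show "k < partner k" "partner k < k + 2 * n" "U (partner k) = \<alpha> (U k)" by simp_all
qed

lemma partner_unique:
  assumes "k < j" "j < k + 2 * n" "U j = \<alpha> (U k)"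
  shows "j = partner k"
  by (rule U_window[of _ _ k]) (use assms partner[of k] in auto)

lemma U_period: "U (k + 2 * n) = U k"
  by (simp add: U_eq_iff)

lemma partner_period: "partner (k + 2 * n) = partner k + 2 * n"
  by (rule partner_unique[symmetric]) (use partner[of k] in \<open>auto simp: U_period\<close>)

lemma partner_partner: "partner (partner k) = k + 2 * n"
  by (rule partner_unique[symmetric])
    (use partner[of k] in \<open>auto simp: U_period matchingD(3)[OF m]\<close>)

lemma partner_neq_Suc: "partner k \<noteq> Suc k"
proof
  assume "partner k = Suc k"
  then have "rot n (\<alpha> (U k)) = \<alpha> (U k)" using partner(3)[of k] U_Suc[of k] by simp
  moreover have "\<alpha> (U k) < 2 * n" using U_less[of k] by (simp add: matchingD(4)[OF m])
  ultimately show False using rot_neq(1) by blast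
qed

lemma partner_Suc_neq: "partner (Suc k) \<noteq> partner k"
proof
  assume "partner (Suc k) = partner k"
  then have "U (Suc k) = U k" using partner(3)[of k] partner(3)[of "Suc k"] matchingD(5)[OF m] by simp
  then have "Suc k = k" by (rule U_window[of _ _ k]) (use n in auto)
  then show False by simp
qed

text \<open>Increasing and compatible with the period, \<open>partner\<close> must grow by exactly
  one each time; applied twice it adds 2n, so it adds n. This is a half turn in the order around the
  vertex, not yet in the polygon: one step of \<open>rot\<close> is n + 1 places in that order, and
  n such steps amount to n places modulo 2n because n is even.\<close>

lemma partner_mono_imp_bolza:
  assumes "even n" "\<And>k. partner k < partner (Suc k)"
  shows "\<alpha> = bolza_map n"
proof -
  have le: "partner k + i \<le> partner (k + i)" for k i
  proof (induction i)
    case (Suc i)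
    then show ?case using assms(2)[of "k + i"] by simp
  qed simp
  have Suc: "partner (Suc k) = Suc (partner k)" for k
    using assms(2)[of k] le[of "Suc k" "2 * n - 1"] partner_period[of k] n by simp
  have shift: "partner k = partner 0 + k" for k
    by (induction k) (simp_all add: Suc)
  have "partner 0 = n" using partner_partner[of 0] shift[of "partner 0"] by simp
  then have \<alpha>U: "\<alpha> (U k) = U (k + n)" for k
    using partner(3)[of k] shift[of k] by (simp add: add.commute)
  have rotU: "rot n (U k) = U (k + (n + 1))" for k
  proof -
    have "rot n (U (k + 2 * n)) = U (Suc (k + n))"
      using U_Suc[of "k + n"] by (simp add: \<alpha>U add.assoc mult_2)
    then show ?thesis by (simp add: U_period)
  qed
  have rot_pow: "(rot n ^^ i) (U k) = U (k + i * (n + 1))" for i k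
    by (induction i) (simp_all add: rotU algebra_simps)
  have "\<alpha> x = (x + n) mod (2 * n)" if "x < 2 * n" for x
  proof -
    obtain k where k: "U k = x" using U_surj[OF \<open>x < 2 * n\<close>] .
    obtain h where h: "n = 2 * h" using assms(1) by blast
    have "k + n * (n + 1) = k + n + 2 * n * h" by (simp add: h algebra_simps)
    then have "U (k + n * (n + 1)) = U (k + n)" unfolding U_eq_iff by (simp only: mod_mult_self2)
    then have "\<alpha> x = (rot n ^^ n) x" using rot_pow[of n k] by (simp add: k \<alpha>U flip: k)
    then show ?thesis using that by (simp add: rot_funpow)
  qed
  then show ?thesis using matchingD(6)[OF m] by (auto simp: fun_eq_iff bolza_map_def)
qed

text \<open>\<open>partner k < partner (Suc k)\<close> says that the chords met at times
  \<open>k\<close> and \<open>Suc k\<close> cross. Passing from \<open>k\<close> to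
  \<open>partner (Suc k)\<close> advances by one side of the polygon, so if non-crossing were always
  inherited it would spread all around, and \<open>partner\<close> would decrease forever.\<close>

lemma ex_crossing_turn:
  assumes "even n" "\<alpha> \<noteq> bolza_map n"
  obtains k where "partner (Suc k) < partner k"
    "partner (partner (Suc k)) < partner (Suc (partner (Suc k)))"
proof (rule ccontr)
  note result = that
  assume "\<not> thesis"
  then have *: "\<not> partner (partner (Suc k)) < partner (Suc (partner (Suc k)))"
    if "\<not> partner k < partner (Suc k)" for k
    using result[of k] that partner_Suc_neq[of k] by linarith
  obtain k0 where k0: "\<not> partner k0 < partner (Suc k0)"
    using partner_mono_imp_bolza assms by blast
  let ?G = "\<lambda>k. partner (Suc k)"
  have G: "\<not> partner ((?G ^^ i) k0) < partner (Suc ((?G ^^ i) k0))" for i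
    by (induction i) (use k0 * in auto)
  have UG: "U (Suc ((?G ^^ i) k0)) = (rot n ^^ i) (U (Suc k0))" for i
    by (induction i) (simp_all add: U_Suc[of "partner _"] partner(3) matchingD(3)[OF m])
  have per: "partner (k + 2 * n * i) = partner k + 2 * n * i" for k i
  proof (induction i)
    case (Suc i)
    then show ?case using partner_period[of "k + 2 * n * i"] by (simp add: algebra_simps)
  qed simp
  have mod_eq: "partner k < partner (Suc k) \<longleftrightarrow>
      partner (k mod (2 * n)) < partner (Suc (k mod (2 * n)))" for k
    using per[of "k mod (2 * n)" "k div (2 * n)"] per[of "Suc (k mod (2 * n))" "k div (2 * n)"]
    by simp
  have "\<not> partner j < partner (Suc j)" for j
  proof -
    obtain i where "(rot n ^^ i) (U (Suc k0)) = U (Suc j)"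
      using rot_transitive U_less by metis
    then have "U (Suc ((?G ^^ i) k0)) = U (Suc j)" by (simp add: UG)
    then have "\<alpha> (U ((?G ^^ i) k0)) = \<alpha> (U j)" using rot_inj by (auto simp: U_Suc)
    then have "(?G ^^ i) k0 mod (2 * n) = j mod (2 * n)" by (simp add: matchingD(5)[OF m] U_eq_iff)
    then show ?thesis using G[of i] mod_eq[of j] mod_eq[of "(?G ^^ i) k0"] by simp
  qed
  then have desc: "partner (Suc k) < partner k" for k
    using partner_Suc_neq[of k] by (metis linorder_neqE_nat)
  have "partner k + k \<le> partner 0" for k
  proof (induction k)
    case (Suc k)
    then show ?case using desc[of k] by simp
  qed simp
  from this[of "Suc (partner 0)"] show False by simp
qed

text \<open>With \<open>l = partner (Suc k)\<close>, ungluing the side at time \<open>Suc k\<close>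
  cuts the cycle into the times from l + 1 to k + 1 + 2n and the rest. Non-crossing at
  \<open>k\<close> puts \<open>p\<close> into the first piece; crossing at \<open>l\<close> puts the
  partner of \<open>rot n (rot n p)\<close> into the second.\<close>

lemma ex_join_around:
  assumes "even n" "\<alpha> \<noteq> bolza_map n"
  obtains p where "p < 2 * n"
    "\<alpha> (rot n (rot n p)) \<notin> orbit (vertex_perm n \<alpha> \<circ> transpose (rot n p) (\<alpha> (rot n p))) p"
proof -
  obtain k where k: "partner (Suc k) < partner k"
    "partner (partner (Suc k)) < partner (Suc (partner (Suc k)))"
    by (rule ex_crossing_turn[OF assms])
  define l where "l = partner (Suc k)"
  define p where "p = \<alpha> (U k)"
  have s: "rot n p = U (Suc k)" by (simp add: p_def U_Suc)
  have q: "\<alpha> (rot n p) = U l" using partner(3)[of "Suc k"] by (simp add: s l_def)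
  have r: "rot n (rot n p) = U (Suc l)" by (simp add: U_Suc[of l] matchingD(3)[OF m] flip: q)
  have ar: "\<alpha> (rot n (rot n p)) = U (partner (Suc l))" by (simp add: r partner(3))
  have l: "Suc k < l" "l < partner k" "partner k < k + 2 * n" "partner k < Suc (k + 2 * n)"
    using k(1) partner[of k] partner(1)[of "Suc k"] by (auto simp: l_def)
  have big: "Suc k + 2 * n < partner (Suc l)"
    using k(2) partner_partner[of "Suc k"] by (simp add: l_def)
  have "partner (Suc l) \<noteq> l + 2 * n"
  proof
    assume "partner (Suc l) = l + 2 * n"
    then have "partner (l + 2 * n) = Suc l + 2 * n" using partner_partner[of "Suc l"] by simp
    then show False using partner_neq_Suc[of l] by (simp add: partner_period)
  qed
  then have small: "partner (Suc l) < l + 2 * n" using partner(2)[of "Suc l"] by simp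
  let ?B = "{U i | i. l < i \<and> i \<le> Suc k + 2 * n}"
  let ?f = "vertex_perm n \<alpha>"
  have fU: "?f (U i) = U (Suc i)" for i by (simp add: vertex_perm_apply U_Suc)
  have "orbit (?f \<circ> transpose (U (Suc k)) (U l)) p \<subseteq> ?B"
  proof (rule orbit_subset_closed)
    show "p \<in> ?B" unfolding p_def partner(3)[symmetric] using l by force
  next
    fix y assume "y \<in> ?B"
    then obtain i where i: "y = U i" "l < i" "i \<le> Suc k + 2 * n" by blast
    show "(?f \<circ> transpose (U (Suc k)) (U l)) y \<in> ?B"
    proof (cases "i = Suc k + 2 * n")
      case True
      then have "y = U (Suc k)" using U_period[of "Suc k"] i by simp
      then have "(?f \<circ> transpose (U (Suc k)) (U l)) y = U (Suc l)" by (simp add: fU)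
      moreover have "l < Suc l" "Suc l \<le> Suc k + 2 * n" using l by auto
      ultimately show ?thesis by blast
    next
      case False
      have "U i \<noteq> U (Suc k + 2 * n)" "U i \<noteq> U l"
        using U_window[of i "Suc k + 2 * n" l] U_window[of i l l] i l False by auto
      then have "(?f \<circ> transpose (U (Suc k)) (U l)) y = U (Suc i)"
        using U_period[of "Suc k"] by (simp add: i fU)
      moreover have "l < Suc i" "Suc i \<le> Suc k + 2 * n" using i False by auto
      ultimately show ?thesis by blast
    qed
  qed
  moreover have "U (partner (Suc l)) \<notin> ?B"
  proof
    assume "U (partner (Suc l)) \<in> ?B"
    then obtain i where "U (partner (Suc l)) = U i" "l < i" "i \<le> Suc k + 2 * n" by auto
    then show False using U_window[of "partner (Suc l)" i l] big small l by auto
  qed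
  moreover have "p < 2 * n" using U_less matchingD(4)[OF m] by (simp add: p_def)
  ultimately show thesis using that[of p] unfolding ar unfolding s q[unfolded s] by blast
qed

end

section \<open>Adding and removing leaves and handles\<close>

lemma num_cycles_insert_fixed:
  assumes "f permutes A" "finite A" "a \<notin> A"
  shows "num_cycles (insert a A) f = num_cycles A f + 1"
proof -
  have "f a = a" using assms permutes_not_in by metis
  then have "orbit f ` insert a A = insert {a} (orbit f ` A)" by (simp add: orbit_eq_singleton_iff[THEN iffD2])
  moreover have "{a} \<notin> orbit f ` A"
    using permutes_orbit_subset[OF assms(1)] assms(3) by blast
  ultimately show ?thesis using assms(2) by (simp add: num_cycles_def)
qed

text \<open>\<open>b\<close> is a fixed point of \<open>f\<close>, and the transposition inserts it
  into the cycle right after \<open>a\<close>.\<close>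

lemma num_cycles_extend:
  assumes "f permutes A" "finite A" "a \<in> A" "b \<notin> A"
  shows "num_cycles (insert b A) (f \<circ> transpose a b) = num_cycles A f"
    and "f \<circ> transpose a b permutes insert b A"
proof -
  have p: "f permutes insert b A" using assms(1) by (rule permutes_subset) blast
  then show "f \<circ> transpose a b permutes insert b A"
    using assms(3) by (intro permutes_compose permutes_swap_id) auto
  have "b \<notin> orbit f a" using permutes_orbit_subset[OF assms(1,3)] assms(4) by blast
  then have "num_cycles (insert b A) (f \<circ> transpose a b) + 1 = num_cycles (insert b A) f"
    using assms p by (intro num_cycles_merge) auto
  then show "num_cycles (insert b A) (f \<circ> transpose a b) = num_cycles A f"
    using num_cycles_insert_fixed[OF assms(1,2,4)] by simp
qed

text \<open>The leaf takes the last two sides. Written as a product with a transposition, the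
  operation is its own inverse and also serves to remove the leaf; \<open>add_handle\<close> has the
  same form on the last four sides.\<close>

definition add_leaf :: "nat \<Rightarrow> (nat \<Rightarrow> nat) \<Rightarrow> nat \<Rightarrow> nat" where
  "add_leaf m \<alpha> = \<alpha> \<circ> transpose (2 * m) (2 * m + 1)"

definition add_handle :: "nat \<Rightarrow> (nat \<Rightarrow> nat) \<Rightarrow> nat \<Rightarrow> nat" where
  "add_handle m \<alpha> = \<alpha> \<circ> (transpose (2 * m) (2 * m + 2) \<circ> transpose (2 * m + 1) (2 * m + 3))"

lemma add_leaf_apply:
  assumes "matching m \<alpha>"
  shows "add_leaf m \<alpha> x = (if x = 2 * m then 2 * m + 1 else if x = 2 * m + 1 then 2 * m else \<alpha> x)"
  using matchingD(6)[OF assms] by (simp add: add_leaf_def transpose_def)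

lemma add_handle_apply:
  assumes "matching m \<alpha>"
  shows "add_handle m \<alpha> x =
    (if x = 2 * m then 2 * m + 2 else if x = 2 * m + 1 then 2 * m + 3
     else if x = 2 * m + 2 then 2 * m else if x = 2 * m + 3 then 2 * m + 1 else \<alpha> x)"
  using matchingD(6)[OF assms] by (simp add: add_handle_def transpose_def)

lemma add_leaf_matching:
  assumes "matching m \<alpha>"
  shows "matching (m + 1) (add_leaf m \<alpha>)"
proof (rule matchingI)
  fix x
  note D = matchingD[OF assms]
  have lt: "\<alpha> x < 2 * m" if "x < 2 * m" using that D(4) by simp
  show "add_leaf m \<alpha> x < 2 * (m + 1)" if "x < 2 * (m + 1)"
    using that lt by (auto simp: add_leaf_apply[OF assms])
  show "add_leaf m \<alpha> x \<noteq> x" if "x < 2 * (m + 1)"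
    using that D(2)[of x] by (auto simp: add_leaf_apply[OF assms])
  show "add_leaf m \<alpha> (add_leaf m \<alpha> x) = x" if "x < 2 * (m + 1)"
    using that lt D(3)[of x] by (auto simp: add_leaf_apply[OF assms])
  show "add_leaf m \<alpha> x = x" if "2 * (m + 1) \<le> x"
    using that D(6)[of x] by (auto simp: add_leaf_apply[OF assms])
qed

lemma add_handle_matching:
  assumes "matching m \<alpha>"
  shows "matching (m + 2) (add_handle m \<alpha>)"
proof (rule matchingI)
  fix x
  note D = matchingD[OF assms]
  have lt: "\<alpha> x < 2 * m" if "x < 2 * m" using that D(4) by simp
  show "add_handle m \<alpha> x < 2 * (m + 2)" if "x < 2 * (m + 2)"
    using that lt by (auto simp: add_handle_apply[OF assms])
  show "add_handle m \<alpha> x \<noteq> x" if "x < 2 * (m + 2)"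
    using that D(2)[of x] by (auto simp: add_handle_apply[OF assms])
  show "add_handle m \<alpha> (add_handle m \<alpha> x) = x" if x: "x < 2 * (m + 2)"
  proof (cases "x < 2 * m")
    case True
    have "add_handle m \<alpha> y = \<alpha> y" if "y < 2 * m" for y
      using that by (simp add: add_handle_apply[OF assms])
    then show ?thesis using lt True D(3) by simp
  next
    case False
    then have "x = 2 * m \<or> x = 2 * m + 1 \<or> x = 2 * m + 2 \<or> x = 2 * m + 3"
      using x by arith
    then show ?thesis by (elim disjE) (simp_all add: add_handle_apply[OF assms])
  qed
  show "add_handle m \<alpha> x = x" if "2 * (m + 2) \<le> x"
    using that D(6)[of x] by (auto simp: add_handle_apply[OF assms])
qed

lemma remove_leaf:
  assumes "matching (m + 1) \<beta>" "\<beta> (2 * m) = 2 * m + 1"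
  obtains \<alpha> where "matching m \<alpha>" "\<beta> = add_leaf m \<alpha>"
proof
  note D = matchingD[OF assms(1)]
  have b: "\<beta> (2 * m + 1) = 2 * m" using D(3)[of "2 * m"] assms(2) by simp
  let ?\<alpha> = "add_leaf m \<beta>"
  have a: "?\<alpha> x = (if x < 2 * m then \<beta> x else x)" for x
    using assms(2) b D(6)[of x] by (auto simp: add_leaf_def transpose_def)
  have lt: "\<beta> x < 2 * m" if "x < 2 * m" for x
  proof -
    have "\<beta> x \<noteq> 2 * m" "\<beta> x \<noteq> 2 * m + 1" using D(3)[of x] assms(2) b that by auto
    moreover have "\<beta> x < 2 * (m + 1)" using that D(4) by simp
    ultimately show ?thesis by simp
  qed
  show "matching m ?\<alpha>" by (rule matchingI) (use lt D in \<open>auto simp: a\<close>)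
  show "\<beta> = add_leaf m ?\<alpha>" by (simp add: add_leaf_def fun_eq_iff)
qed

lemma remove_handle:
  assumes "matching (m + 2) \<beta>" "handle (m + 2) \<beta> (2 * m)"
  obtains \<alpha> where "matching m \<alpha>" "\<beta> = add_handle m \<alpha>"
proof
  note D = matchingD[OF assms(1)]
  have h: "\<beta> (2 * m) = 2 * m + 2" "\<beta> (2 * m + 1) = 2 * m + 3"
    using assms(2) by (simp_all add: handle_def rot_eq numeral_eq_Suc)
  then have b: "\<beta> (2 * m + 2) = 2 * m" "\<beta> (2 * m + 3) = 2 * m + 1"
    using D(3)[of "2 * m"] D(3)[of "2 * m + 1"] by simp_all
  let ?\<alpha> = "add_handle m \<beta>"
  have a: "?\<alpha> x = (if x < 2 * m then \<beta> x else x)" for x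
    using h b D(6)[of x] by (auto simp: add_handle_def transpose_def)
  have lt: "\<beta> x < 2 * m" if "x < 2 * m" for x
  proof -
    have "\<beta> x \<noteq> 2 * m" "\<beta> x \<noteq> 2 * m + 1" "\<beta> x \<noteq> 2 * m + 2" "\<beta> x \<noteq> 2 * m + 3"
      using D(3)[of x] h b that by auto
    moreover have "\<beta> x < 2 * (m + 2)" using that D(4) by simp
    ultimately show ?thesis by simp
  qed
  show "matching m ?\<alpha>" by (rule matchingI) (use lt D in \<open>auto simp: a\<close>)
  show "\<beta> = add_handle m ?\<alpha>" by (auto simp: add_handle_def fun_eq_iff transpose_def)
qed

text \<open>Let \<open>c\<close> be the vertex that was sent to 0. In the larger polygon the arrow
  from \<open>c\<close> to 0 passes through the new vertex 2m, and 2m + 1 becomes a cycle of its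
  own.\<close>

lemma num_vertices_add_leaf:
  assumes "matching m \<alpha>" "m \<ge> 1"
  shows "num_vertices (m + 1) (add_leaf m \<alpha>) = num_vertices m \<alpha> + 1"
proof -
  let ?f = "vertex_perm m \<alpha>"
  define c where "c = \<alpha> (2 * m - 1)"
  note D = matchingD[OF assms(1)]
  have c: "c < 2 * m" "\<alpha> c = 2 * m - 1" using D(3,4) assms(2) by (simp_all add: c_def)
  have ceq: "\<alpha> x = 2 * m - 1 \<longleftrightarrow> x = c" for x using D(3) c(2) by metis
  let ?g = "?f \<circ> transpose c (2 * m)"
  have f: "?f permutes {..<2 * m}" by (rule vertex_perm_permutes) fact
  have eq: "vertex_perm (m + 1) (add_leaf m \<alpha>) = ?g"
  proof
    fix x
    consider "x < 2 * m" "x \<noteq> c" | "x = c" | "x = 2 * m" | "x = 2 * m + 1" | "x \<ge> 2 * m + 2" by linarith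
    then show "vertex_perm (m + 1) (add_leaf m \<alpha>) x = ?g x"
    proof cases
      case 1
      then have "\<alpha> x < 2 * m" "\<alpha> x \<noteq> 2 * m - 1" using D(4) ceq by auto
      then show ?thesis using 1 by (auto simp: vertex_perm_apply add_leaf_apply[OF assms(1)] rot_eq)
    next
      case 2
      then show ?thesis using c assms(2) D(6)[of "2 * m"]
        by (simp add: vertex_perm_apply add_leaf_apply[OF assms(1)] rot_eq) (simp add: rot_def)
    next
      case 3
      then show ?thesis using c assms(2)
        by (simp add: vertex_perm_apply add_leaf_apply[OF assms(1)] rot_eq)
    next
      case 4
      then show ?thesis using c D(6)[of x]
        by (simp add: vertex_perm_apply add_leaf_apply[OF assms(1)] rot_eq) (simp add: rot_def)
    next
      case 5
      then show ?thesis using c D(6)[of x]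
        by (simp add: vertex_perm_apply add_leaf_apply[OF assms(1)] rot_def)
    qed
  qed
  note e = num_cycles_extend[OF f finite_lessThan, of c "2 * m"]
  have "{..<2 * (m + 1)} = insert (2 * m + 1) (insert (2 * m) {..<2 * m})" by auto
  then show ?thesis
    using num_cycles_insert_fixed[OF e(2), of "2 * m + 1"] e(1) c(1)
    unfolding num_vertices_def eq by simp
qed

text \<open>All four new vertices are strung into an existing cycle: the arrow from \<open>c\<close>
  to 0 becomes the path c, 2m, 2m + 3, 2m + 2, 2m + 1, 0.\<close>

lemma num_vertices_add_handle:
  assumes "matching m \<alpha>" "m \<ge> 1"
  shows "num_vertices (m + 2) (add_handle m \<alpha>) = num_vertices m \<alpha>"
proof -
  let ?f = "vertex_perm m \<alpha>"
  define c where "c = \<alpha> (2 * m - 1)"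
  note D = matchingD[OF assms(1)]
  have c: "c < 2 * m" "\<alpha> c = 2 * m - 1" using D(3,4) assms(2) by (simp_all add: c_def)
  have ceq: "\<alpha> x = 2 * m - 1 \<longleftrightarrow> x = c" for x using D(3) c(2) by metis
  have f: "?f permutes {..<2 * m}" by (rule vertex_perm_permutes) fact
  have out: "?f x = x" if "x \<ge> 2 * m" for x
    using that by (simp add: vertex_perm_apply D(6) rot_def)
  let ?g1 = "?f \<circ> transpose c (2 * m)"
  let ?g2 = "?g1 \<circ> transpose (2 * m) (2 * m + 3)"
  let ?g3 = "?g2 \<circ> transpose (2 * m + 3) (2 * m + 2)"
  let ?g4 = "?g3 \<circ> transpose (2 * m + 2) (2 * m + 1)"
  have eq: "vertex_perm (m + 2) (add_handle m \<alpha>) = ?g4"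
  proof
    fix x
    consider "x < 2 * m" "x \<noteq> c" | "x = c" | "x = 2 * m" | "x = 2 * m + 1" | "x = 2 * m + 2"
      | "x = 2 * m + 3" | "x \<ge> 2 * m + 4" by linarith
    then show "vertex_perm (m + 2) (add_handle m \<alpha>) x = ?g4 x"
    proof cases
      case 1
      then have "\<alpha> x < 2 * m" "\<alpha> x \<noteq> 2 * m - 1" using D(4) ceq by auto
      then show ?thesis using 1 by (auto simp: vertex_perm_apply add_handle_apply[OF assms(1)] rot_eq)
    next
      case 2
      then have "?g4 x = 2 * m" using c out by simp
      then show ?thesis using 2 c assms(2)
        by (simp add: vertex_perm_apply add_handle_apply[OF assms(1)] rot_eq)
    next
      case 4
      then have "?g4 x = ?f c" using c by (simp add: transpose_def)
      then show ?thesis using 4 c assms(2)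
        by (simp add: vertex_perm_apply add_handle_apply[OF assms(1)] rot_eq)
    next
      case 7
      then show ?thesis using c D(6)[of x]
        by (simp add: vertex_perm_apply add_handle_apply[OF assms(1)] rot_def)
    qed (use c out in \<open>simp_all add: transpose_def, simp_all add: vertex_perm_apply add_handle_apply[OF assms(1)] rot_eq\<close>)
  qed
  note e1 = num_cycles_extend[OF f finite_lessThan, of c "2 * m"]
  have "num_cycles (insert (2 * m) {..<2 * m}) ?g1 = num_cycles {..<2 * m} ?f"
    and p1: "?g1 permutes insert (2 * m) {..<2 * m}"
    using e1 c by simp_all
  moreover note e2 = num_cycles_extend[OF p1, of "2 * m" "2 * m + 3"]
  have "num_cycles (insert (2 * m + 3) (insert (2 * m) {..<2 * m})) ?g2 = num_cycles (insert (2 * m) {..<2 * m}) ?g1"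
    and p2: "?g2 permutes insert (2 * m + 3) (insert (2 * m) {..<2 * m})"
    using e2 by simp_all
  moreover note e3 = num_cycles_extend[OF p2, of "2 * m + 3" "2 * m + 2"]
  have "num_cycles (insert (2 * m + 2) (insert (2 * m + 3) (insert (2 * m) {..<2 * m}))) ?g3
      = num_cycles (insert (2 * m + 3) (insert (2 * m) {..<2 * m})) ?g2"
    and p3: "?g3 permutes insert (2 * m + 2) (insert (2 * m + 3) (insert (2 * m) {..<2 * m}))"
    using e3 by simp_all
  moreover note e4 = num_cycles_extend[OF p3, of "2 * m + 2" "2 * m + 1"]
  have "num_cycles (insert (2 * m + 1) (insert (2 * m + 2) (insert (2 * m + 3) (insert (2 * m) {..<2 * m})))) ?g4
      = num_cycles (insert (2 * m + 2) (insert (2 * m + 3) (insert (2 * m) {..<2 * m}))) ?g3"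
    using e4(1) by simp
  moreover have "{..<2 * (m + 2)}
      = insert (2 * m + 1) (insert (2 * m + 2) (insert (2 * m + 3) (insert (2 * m) {..<2 * m})))"
    by auto
  ultimately show ?thesis unfolding num_vertices_def eq by simp
qed

text \<open>The attached piece lives on sides outside the smaller polygon and is not affected by
  swaps inside; this lifts paths to the larger polygon.\<close>

lemma join_comp:
  assumes "matching m \<alpha>" "swappable m \<alpha> p r"
    and \<tau>: "\<And>x. x < 2 * m \<Longrightarrow> \<tau> x = x" "\<And>x. x \<ge> 2 * m \<Longrightarrow> \<tau> x \<ge> 2 * m"
  shows "join (\<alpha> \<circ> \<tau>) p r = join \<alpha> p r \<circ> \<tau>"
proof
  fix x
  note d = swappable_distinct(1-4)[OF assms(1,2)]
  show "join (\<alpha> \<circ> \<tau>) p r x = (join \<alpha> p r \<circ> \<tau>) x"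
  proof (cases "x < 2 * m")
    case True
    then show ?thesis using d \<tau>(1) by (auto simp: join_def transpose_def)
  next
    case False
    then have "\<tau> x \<ge> 2 * m" "x \<ge> 2 * m" using \<tau>(2) by auto
    then have "\<tau> x \<notin> {p, r, \<alpha> p, \<alpha> r}" "x \<notin> {p, r, \<alpha> p, \<alpha> r}" using d by auto
    then show ?thesis using d \<tau>(1) by (auto simp: join_def)
  qed
qed

lemma reach_add_leaf:
  assumes "reach m \<alpha> \<beta>" "m \<ge> 1"
  shows "reach (m + 1) (add_leaf m \<alpha>) (add_leaf m \<beta>)"
  using assms(1)
proof induction
  case (step \<beta> \<gamma>)
  then obtain p r where s: "matching m \<beta>" "num_vertices m \<gamma> = num_vertices m \<beta>"
    "swappable m \<beta> p r" "\<gamma> = join \<beta> p r" by (auto simp: step_def)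
  have m: "matching m \<gamma>" using step(2) by (rule step_matching)
  have "add_leaf m \<gamma> = join (add_leaf m \<beta>) p r"
    unfolding s(4) add_leaf_def
    by (rule join_comp[symmetric, OF s(1,3)]) (auto simp: transpose_def)
  moreover have "swappable (m + 1) (add_leaf m \<beta>) p r"
    using s(3) by (auto simp: swappable_def add_leaf_apply[OF s(1)])
  moreover have "num_vertices (m + 1) (add_leaf m \<gamma>) = num_vertices (m + 1) (add_leaf m \<beta>)"
    using s(1,2) m assms(2) by (simp only: num_vertices_add_leaf)
  ultimately have "step (m + 1) (add_leaf m \<beta>) (add_leaf m \<gamma>)"
    using add_leaf_matching[OF s(1)] unfolding step_def by blast
  with step.IH show ?case by (rule reach_step)
qed simp

lemma reach_add_handle:
  assumes "reach m \<alpha> \<beta>" "m \<ge> 1"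
  shows "reach (m + 2) (add_handle m \<alpha>) (add_handle m \<beta>)"
  using assms(1)
proof induction
  case (step \<beta> \<gamma>)
  then obtain p r where s: "matching m \<beta>" "num_vertices m \<gamma> = num_vertices m \<beta>"
    "swappable m \<beta> p r" "\<gamma> = join \<beta> p r" by (auto simp: step_def)
  have m: "matching m \<gamma>" using step(2) by (rule step_matching)
  have "add_handle m \<gamma> = join (add_handle m \<beta>) p r"
    unfolding s(4) add_handle_def
    by (rule join_comp[symmetric, OF s(1,3)]) (auto simp: transpose_def)
  moreover have "swappable (m + 2) (add_handle m \<beta>) p r"
    using s(3) by (auto simp: swappable_def add_handle_apply[OF s(1)])
  moreover have "num_vertices (m + 2) (add_handle m \<gamma>) = num_vertices (m + 2) (add_handle m \<beta>)"
    using s(1,2) m assms(2) by (simp only: num_vertices_add_handle)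
  ultimately have "step (m + 2) (add_handle m \<beta>) (add_handle m \<gamma>)"
    using add_handle_matching[OF s(1)] unfolding step_def by blast
  with step.IH show ?case by (rule reach_step)
qed simp

section \<open>Bolza diagrams and connectivity\<close>

lemma bolza_map_eq:
  "bolza_map n x = (if x < n then x + n else if x < 2 * n then x - n else x)"
proof -
  have "(x + n) mod (2 * n) = x - n" if "n \<le> x" "x < 2 * n"
  proof -
    have "x + n = x - n + 2 * n" using that by simp
    then show ?thesis using that by (metis mod_add_self2 mod_less less_imp_diff_less)
  qed
  then show ?thesis by (auto simp: bolza_map_def)
qed

lemma bolza_matching: "n \<ge> 1 \<Longrightarrow> matching n (bolza_map n)"
  by (rule matchingI) (auto simp: bolza_map_eq)

lemma bolza_vertex_funpow:
  assumes "even n" "x < 2 * n"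
  shows "(vertex_perm n (bolza_map n) ^^ k) x = (x + k * (n + 1)) mod (2 * n)"
proof (induction k)
  case (Suc k)
  have "0 < n" using assms(2) by simp
  then show ?case
    using Suc by (simp add: vertex_perm_apply bolza_map_def rot_def mod_simps algebra_simps)
qed (use assms in simp)

text \<open>The vertex permutation is translation by n + 1, and for even n the square of n + 1 is 1
  modulo 2n. Hence (y - x)(n + 1) steps lead from x to y; y - x is written as
  \<open>y + (2 * n - x)\<close>.\<close>

lemma bolza_orbit:
  assumes "even n" "x < 2 * n" "y < 2 * n"
  shows "y \<in> orbit (vertex_perm n (bolza_map n)) x"
proof -
  obtain h where h: "n = 2 * h" using assms(1) by blast
  have n: "n \<ge> 1" using assms(2) by simp
  have "x + ((y + (2 * n - x)) * (n + 1)) * (n + 1)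
      = y + 2 * n * (1 + (y + (2 * n - x)) * (h + 1))"
  proof -
    have "x + z * (n + 1) * (n + 1) = x + z + 2 * n * (z * (h + 1))" for z
      by (simp add: h algebra_simps)
    from this[of "y + (2 * n - x)"] show ?thesis using assms(2) by (simp add: algebra_simps)
  qed
  then have "(vertex_perm n (bolza_map n) ^^ ((y + (2 * n - x)) * (n + 1))) x = y"
    using assms(3) by (simp only: bolza_vertex_funpow[OF assms(1,2)] mod_mult_self2) simp
  moreover have "(vertex_perm n (bolza_map n) ^^ k) x \<in> orbit (vertex_perm n (bolza_map n)) x" for k
    by (intro funpow_in_orbit permutation_self_in_orbit vertex_perm_permutation bolza_matching n)
  ultimately show ?thesis by metis
qed

lemma bolza_one_vertex:
  assumes "even n" "n \<ge> 1"
  shows "num_vertices n (bolza_map n) = 1"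
proof -
  have "{..<2 * n} \<noteq> {}" using assms(2) by (auto simp: lessThan_empty_iff)
  then show ?thesis
    unfolding num_vertices_def
    using num_cycles_Suc_0_iff[OF vertex_perm_permutes[OF bolza_matching[OF assms(2)]] finite_lessThan]
      bolza_orbit[OF assms(1)] by simp
qed

text \<open>Base of the induction: a one-vertex diagram has no leaf, and among four sides the only
  non-neighbour of a side is the opposite one.\<close>

lemma two_chords_one_vertex:
  assumes "matching 2 \<alpha>" "num_vertices 2 \<alpha> = 1"
  shows "\<alpha> = bolza_map 2"
proof -
  note D = matchingD[OF assms(1)]
  note L = one_vertex_no_leaf[OF assms]
  have n: "\<alpha> 0 \<noteq> 1" "\<alpha> 1 \<noteq> 2" "\<alpha> 2 \<noteq> 3" "\<alpha> 0 \<noteq> 3"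
    using L(1)[of 0] L(1)[of 1] L(1)[of 2] L(2)[of 3] by (simp_all add: rot_eq)
  have "\<alpha> 0 < 4" "\<alpha> 1 < 4" "\<alpha> 0 \<noteq> 0" "\<alpha> 1 \<noteq> 1" using D(4)[of 0] D(4)[of 1] D(2) by simp_all
  then have 0: "\<alpha> 0 = 2" using n by linarith
  then have 2: "\<alpha> 2 = 0" using D(3)[of 0] by simp
  have "\<alpha> 1 \<noteq> 0"
  proof
    assume "\<alpha> 1 = 0"
    then show False using D(3)[of 1] 0 by simp
  qed
  then have 1: "\<alpha> 1 = 3" using n \<open>\<alpha> 1 < 4\<close> \<open>\<alpha> 1 \<noteq> 1\<close> by linarith
  then have 3: "\<alpha> 3 = 1" using D(3)[of 1] by simp
  show ?thesis
  proof
    fix x :: nat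
    consider "x = 0" | "x = 1" | "x = 2" | "x = 3" | "x \<ge> 4" by linarith
    then show "\<alpha> x = bolza_map 2 x"
      using 0 1 2 3 D(6)[of x] by cases (simp_all add: bolza_map_eq)
  qed
qed

section \<open>Reduction to a leaf or a handle on the last sides, and escape from a Bolza
  remainder\<close>

lemma reach_add_leaf_form:
  assumes "matching (m + 1) \<alpha>" "m \<ge> 1" "num_vertices (m + 1) \<alpha> \<noteq> 1"
  obtains \<beta> where "matching m \<beta>" "reach (m + 1) \<alpha> (add_leaf m \<beta>)"
    "num_vertices (m + 1) \<alpha> = num_vertices m \<beta> + 1"
proof -
  have n: "m + 1 \<ge> 2" using assms(2) by simp
  obtain \<gamma> u where g: "reach (m + 1) \<alpha> \<gamma>" "u < 2 * (m + 1)" "\<gamma> u = rot (m + 1) u"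
    using exists_leaf[OF assms(1) n assms(3)] by blast
  have mg: "matching (m + 1) \<gamma>" by (rule reach_matching[OF g(1) assms(1)])
  have "2 * m < 2 * (m + 1)" by simp
  then obtain \<delta> where d: "reach (m + 1) \<gamma> \<delta>" "\<delta> (2 * m) = rot (m + 1) (2 * m)"
    using reach_leaf_at[OF mg n g(2,3)] by blast
  have md: "matching (m + 1) \<delta>" by (rule reach_matching[OF d(1) mg])
  obtain \<beta> where b: "matching m \<beta>" "\<delta> = add_leaf m \<beta>"
    by (rule remove_leaf[OF md]) (use d(2) in \<open>simp_all add: rot_eq\<close>)
  have r: "reach (m + 1) \<alpha> (add_leaf m \<beta>)" using reach_trans[OF g(1) d(1)] b(2) by simp
  then have "num_vertices (m + 1) \<alpha> = num_vertices m \<beta> + 1"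
    using reach_num_vertices[OF r] num_vertices_add_leaf[OF b(1) assms(2)] by simp
  then show thesis using that b(1) r by blast
qed

lemma reach_add_handle_form:
  assumes "matching (m + 2) \<alpha>" "m \<ge> 1" "even m" "num_vertices (m + 2) \<alpha> = 1" "\<alpha> \<noteq> bolza_map (m + 2)"
  obtains \<beta> where "matching m \<beta>" "reach (m + 2) \<alpha> (add_handle m \<beta>)" "num_vertices m \<beta> = 1"
proof -
  let ?n = "m + 2"
  have n: "?n \<ge> 2" "?n \<ge> 3" "?n \<ge> 1" using assms(2) by simp_all
  interpret V: one_vertex ?n \<alpha> by unfold_locales (use assms n in simp_all)
  obtain p where p: "p < 2 * ?n"
    "\<alpha> (rot ?n (rot ?n p)) \<notin> orbit (vertex_perm ?n \<alpha> \<circ> transpose (rot ?n p) (\<alpha> (rot ?n p))) p"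
    using V.ex_join_around assms(3,5) by auto
  have "\<exists>\<gamma>. reach ?n \<alpha> \<gamma> \<and> \<gamma> p = rot ?n (rot ?n p)"
  proof (cases "\<alpha> p = rot ?n (rot ?n p)")
    case False
    note st = step_join_around[OF assms(1,4) n(1) p(1) False p(2)]
    have "join \<alpha> p (rot ?n (rot ?n p)) p = rot ?n (rot ?n p)"
      unfolding join_apply[OF assms(1) st(2)] by simp
    then show ?thesis using st(1) by blast
  qed blast
  then obtain \<gamma> where g: "reach ?n \<alpha> \<gamma>" "\<gamma> p = rot ?n (rot ?n p)" by blast
  have mg: "matching ?n \<gamma>" by (rule reach_matching[OF g(1) assms(1)])
  have "rot ?n (\<gamma> (rot ?n p)) < 2 * ?n" using p(1) unfolding rot_less matchingD(4)[OF mg] .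
  then obtain k where "(rot ?n ^^ k) (rot ?n (\<gamma> (rot ?n p))) = p"
    using rot_transitive p(1) by blast
  then obtain \<delta> t where d: "reach ?n \<gamma> \<delta>" "t < 2 * ?n" "handle ?n \<delta> t"
    using reach_handle_from_short_chord[OF mg p(1) g(2)] by blast
  have md: "matching ?n \<delta>" by (rule reach_matching[OF d(1) mg])
  have "2 * m < 2 * ?n" by simp
  then obtain \<epsilon> where e: "reach ?n \<delta> \<epsilon>" "handle ?n \<epsilon> (2 * m)"
    using reach_handle_at[OF md n(2) d(2,3)] by blast
  obtain \<beta> where b: "matching m \<beta>" "\<epsilon> = add_handle m \<beta>"
    using remove_handle[OF reach_matching[OF e(1) md] e(2)] by blast
  have r: "reach ?n \<alpha> (add_handle m \<beta>)"
    using reach_trans[OF reach_trans[OF g(1) d(1)] e(1)] b(2) by simp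
  then have "num_vertices m \<beta> = 1"
    using reach_num_vertices[OF r] num_vertices_add_handle[OF b(1) assms(2)] assms(4) by simp
  then show thesis using that b(1) r by blast
qed

text \<open>
  Chord words: the swaps lead from \<open>y w y w L L\<close> through \<open>L w y w L y\<close>, and, writing
  \<open>w = w' z\<close>, to \<open>L w' z z w' y L y\<close>. Sliding the leaf \<open>z z\<close> to the end and deleting it leaves a
  chord \<open>L\<close> of length 2, which no Bolza diagram with at least four chords has.
\<close>

lemma bolza_leaf_escape:
  assumes "even m" "m \<ge> 4"
  obtains \<beta> where "matching m \<beta>" "\<beta> \<noteq> bolza_map m"
    "reach (m + 1) (add_leaf m (bolza_map m)) (add_leaf m \<beta>)"
proof -
  define n where "n = m + 1"
  define X where "X = add_leaf m (bolza_map m)"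
  have m1: "m \<ge> 1" and n2: "n \<ge> 2" using assms(2) by (simp_all add: n_def)
  note bm = bolza_matching[OF m1]
  have N: "2 * n = 2 * m + 2" by (simp add: n_def)
  have mX: "matching n X" unfolding n_def X_def by (rule add_leaf_matching[OF bm])
  have X: "X x = (if x = 2 * m then 2 * m + 1 else if x = 2 * m + 1 then 2 * m
      else if x < m then x + m else if x < 2 * m then x - m else x)" for x
    unfolding X_def add_leaf_apply[OF bm] bolza_map_eq by simp
  have VX: "num_vertices n X = 2"
    using num_vertices_add_leaf[OF bm m1] bolza_one_vertex[OF assms(1) m1] by (simp add: X_def n_def)
  let ?f = "vertex_perm n X" and ?A = "{..<2 * n}"
  have f: "?f permutes ?A" by (rule vertex_perm_permutes) fact
  have s1: "swappable n X (2 * m) 0" using m1 by (simp add: swappable_def N X)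
  \<comment> \<open>The tip of the leaf is a vertex by itself, so the first transposition merges it
    into the only other cycle, and the second must split the result.\<close>
  have "?f (2 * m + 1) = 2 * m + 1" by (simp add: vertex_perm_apply X rot_eq N)
  then have o1: "orbit ?f (2 * m + 1) = {2 * m + 1}" by (simp add: orbit_eq_singleton_iff)
  have pf: "permutation ?f" by (rule vertex_perm_permutation) fact
  have "2 * m + 1 \<notin> orbit ?f 0"
    using orbit_sym[OF pf, of "2 * m + 1" 0] unfolding o1 by auto
  then have "num_cycles ?A (?f \<circ> transpose 0 (2 * m + 1)) + 1 = num_cycles ?A ?f"
    using f by (intro num_cycles_merge) (simp_all add: N)
  then have "num_cycles ?A (?f \<circ> transpose 0 (2 * m + 1)) = Suc 0"
    using VX by (simp add: num_vertices_def)
  moreover have "?f \<circ> transpose 0 (2 * m + 1) permutes ?A"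
    using f by (intro permutes_compose permutes_swap_id) (simp_all add: N)
  ultimately have "m \<in> orbit (?f \<circ> transpose 0 (2 * m + 1)) (2 * m)"
    using num_cycles_Suc_0_iff[of "?f \<circ> transpose 0 (2 * m + 1)" ?A] by (simp add: N lessThan_empty_iff)
  then have st1: "step n X (join X (2 * m) 0)"
    by (intro step_join_merge_split[OF mX s1]) (use o1 m1 in \<open>simp_all add: X\<close>)
  define Y where "Y = join X (2 * m) 0"
  have mY: "matching n Y" using step_matching[OF st1] by (simp add: Y_def)
  have Y: "Y x = (if x = 2 * m then 0 else if x = 0 then 2 * m else if x = 2 * m + 1 then m
      else if x = m then 2 * m + 1 else if x < m then x + m else if x < 2 * m then x - m else x)" for x
    unfolding Y_def join_apply[OF mX s1] X using m1 by auto
  \<comment> \<open>The even vertices up to \<open>m\<close> and the odd ones beyond: this set is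
    closed under the vertex permutation of \<open>Y\<close> and separates \<open>2 * m + 1\<close>
    from \<open>m - 1\<close>.\<close>
  let ?S = "{x. if x \<le> m then even x else odd x \<and> x < 2 * m + 2}"
  have "orbit (vertex_perm n Y) (2 * m + 1) \<subseteq> ?S"
  proof (rule orbit_subset_closed)
    show "2 * m + 1 \<in> ?S" by simp
  next
    fix y assume y: "y \<in> ?S"
    have "y = 0 \<or> y = m \<or> y = 2 * m + 1 \<or> y \<noteq> 0 \<and> y < m \<and> even y \<or> y > m \<and> y < 2 * m \<and> odd y"
    proof (cases "y \<le> m")
      case False
      then have "odd y" "y < 2 * m + 2" using y by simp_all
      then have "y < 2 * m \<or> y = 2 * m + 1" by presburger
      then show ?thesis using False \<open>odd y\<close> by auto
    qed (use y in auto)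
    then consider "y = 0" | "y = m" | "y = 2 * m + 1" | "y \<noteq> 0" "y < m" "even y"
      | "y > m" "y < 2 * m" "odd y" by blast
    then show "vertex_perm n Y y \<in> ?S"
    proof cases
      case 4
      then have "y + 1 < m" using assms(1) by presburger
      then have "vertex_perm n Y y = y + m + 1" using 4 by (simp add: vertex_perm_apply Y rot_eq N)
      then show ?thesis using 4 assms(1) \<open>y + 1 < m\<close> by simp
    next
      case 5
      then have "vertex_perm n Y y = y - m + 1" by (simp add: vertex_perm_apply Y rot_eq N)
      then show ?thesis using 5 assms(1) by auto
    qed (use y assms in \<open>auto simp: vertex_perm_apply Y rot_eq N\<close>)
  qed
  moreover have "m - 1 \<notin> ?S" using assms by auto
  ultimately have "m - 1 \<notin> orbit (vertex_perm n Y) (2 * m + 1)" by blast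
  moreover have Ym: "rot n (m - 1) = m" "Y m = 2 * m + 1" "Y (m - 1) = 2 * m - 1"
    using assms(2) by (auto simp: rot_eq N Y)
  ultimately have "Y (rot n (m - 1)) \<notin> orbit (vertex_perm n Y) (m - 1)"
    using orbit_sym[OF vertex_perm_permutation[OF mY]] by auto
  moreover have "m - 1 < 2 * n" "Y (m - 1) \<noteq> rot n (m - 1)" using Ym assms(2) by (simp_all add: N)
  ultimately have st2: "step n Y (join Y (m - 1) m)" and s2: "swappable n Y (m - 1) m"
    using step_create_leaf[OF mY, of "m - 1"] Ym(1) by simp_all
  have r: "reach n X (join Y (m - 1) m)"
    using st1 st2 unfolding Y_def[symmetric] by (meson reach_step rtranclp.rtrancl_refl)
  \<comment> \<open>The leaf starts at \<open>m - 1\<close> and is slid to \<open>2 * m\<close>. The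
    other end of the chord of side 0 drops back by two places when the leaf passes it.\<close>
  have "\<exists>\<beta>. reach n X \<beta> \<and> \<beta> (m - 1 + k) = m + k \<and>
      \<beta> 0 = (if m - 1 + k \<le> 2 * m - 2 then 2 * m else 2 * m - 2)" if "k \<le> m + 1" for k
    using that
  proof (induction k)
    case 0
    have "join Y (m - 1) m (m - 1) = m" "join Y (m - 1) m 0 = 2 * m"
      unfolding join_apply[OF mY s2] using assms(2) by (auto simp: Y)
    then show ?case using r assms(2) by (intro exI[of _ "join Y (m - 1) m"]) simp
  next
    case (Suc k)
    then obtain \<beta> where b: "reach n X \<beta>" "\<beta> (m - 1 + k) = m + k"
      "\<beta> 0 = (if m - 1 + k \<le> 2 * m - 2 then 2 * m else 2 * m - 2)" by auto
    have mb: "matching n \<beta>" by (rule reach_matching[OF b(1) mX])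
    have k: "m - 1 + k < 2 * n" "rot n (m - 1 + k) = m + k" "rot n (m + k) = m + k + 1"
      using Suc.prems assms(2) by (simp_all add: rot_eq N)
    have "\<beta> (m - 1 + k) = rot n (m - 1 + k)" using b(2) k(2) by simp
    note sl = step_slide_leaf[OF mb n2 k(1) this, unfolded k(2,3)]
    have bt: "\<beta> (m + k) = m - 1 + k" using matchingD(3)[OF mb, of "m - 1 + k"] b(2) by simp
    let ?\<gamma> = "join \<beta> (m + k) (m + k + 1)"
    have "?\<gamma> 0 = (if \<beta> 0 = m + k + 1 then m - 1 + k else \<beta> 0)"
    proof (cases "\<beta> 0 = m + k + 1")
      case True
      then have "\<beta> (m + k + 1) = 0" using matchingD(3)[OF mb, of 0] by simp
      then show ?thesis unfolding join_apply[OF mb sl(2)] using True bt assms(2) by simp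
    next
      case False
      then have "\<beta> (m + k + 1) \<noteq> 0" using matchingD(3)[OF mb, of "m + k + 1"] by metis
      then show ?thesis unfolding join_apply[OF mb sl(2)] using False bt assms(2) by simp
    qed
    also have "\<dots> = (if m - 1 + Suc k \<le> 2 * m - 2 then 2 * m else 2 * m - 2)"
      unfolding b(3) using Suc.prems assms(2) by auto
    finally have "?\<gamma> 0 = (if m - 1 + Suc k \<le> 2 * m - 2 then 2 * m else 2 * m - 2)" .
    moreover have "?\<gamma> (m - 1 + Suc k) = m + Suc k" using sl(3) assms(2) by simp
    ultimately show ?case using reach_step[OF b(1) sl(1)] by blast
  qed
  from this[of "m + 1"] obtain \<gamma> where g: "reach n X \<gamma>" "\<gamma> (m - 1 + (m + 1)) = m + (m + 1)"
      "\<gamma> 0 = 2 * m - 2" using assms(2) by auto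
  have idx: "m - 1 + (m + 1) = 2 * m" "m + (m + 1) = 2 * m + 1" using assms(2) by simp_all
  have g2: "\<gamma> (2 * m) = 2 * m + 1" using g(2) unfolding idx .
  have mg: "matching (m + 1) \<gamma>" using reach_matching[OF g(1) mX] by (simp only: n_def)
  obtain \<beta> where b: "matching m \<beta>" "\<gamma> = add_leaf m \<beta>" using remove_leaf[OF mg g2] .
  \<comment> \<open>Cyclically this is at distance two from side 0, whereas the Bolza partner
    \<open>m\<close> is at distance at least four.\<close>
  have "\<beta> 0 = 2 * m - 2" using g(3) assms(2) by (simp add: b(2) add_leaf_apply[OF b(1)])
  then have "\<beta> \<noteq> bolza_map m" using assms(2) by (auto simp: bolza_map_eq)
  then show thesis using that b g(1) by (simp add: n_def X_def)
qed

text \<open>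
  In \<open>w w a b a b\<close>, joining \<open>a\<close> with the chord before the last letter of \<open>w\<close> encloses that
  letter; it completes to a handle disjoint from the chord \<open>b\<close>, which still has length 2 after the
  new handle has been removed.
\<close>

lemma bolza_handle_escape:
  assumes "even m" "m \<ge> 4"
  obtains \<beta> where "matching m \<beta>" "\<beta> \<noteq> bolza_map m"
    "reach (m + 2) (add_handle m (bolza_map m)) (add_handle m \<beta>)"
proof -
  define n where "n = m + 2"
  define X where "X = add_handle m (bolza_map m)"
  have m1: "m \<ge> 1" and n2: "n \<ge> 2" and n3: "n \<ge> 3" using assms(2) by (simp_all add: n_def)
  note bm = bolza_matching[OF m1]
  have N: "2 * n = 2 * m + 4" by (simp add: n_def)
  have mX: "matching n X" unfolding n_def X_def by (rule add_handle_matching[OF bm])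
  have X: "X x = (if x = 2 * m then 2 * m + 2 else if x = 2 * m + 1 then 2 * m + 3
      else if x = 2 * m + 2 then 2 * m else if x = 2 * m + 3 then 2 * m + 1
      else if x < m then x + m else if x < 2 * m then x - m else x)" for x
    unfolding X_def add_handle_apply[OF bm] bolza_map_eq by simp
  have VX: "num_vertices n X = 1"
    using num_vertices_add_handle[OF bm m1] bolza_one_vertex[OF assms(1) m1] by (simp add: X_def n_def)
  let ?f = "vertex_perm n X"
  have fX: "?f x = (if x = 2 * m then 2 * m + 3 else if x = 2 * m + 1 then 0
      else if x = 2 * m + 2 then 2 * m + 1 else if x = 2 * m + 3 then 2 * m + 2
      else if x < m then x + m + 1 else x - m + 1)" if "x < 2 * m + 4" for x
    using that assms(2) by (auto simp: vertex_perm_apply X rot_eq N)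
  define p where "p = 2 * m - 2"
  have p: "p < 2 * n" "rot n p = 2 * m - 1" "rot n (2 * m - 1) = 2 * m"
    using assms(2) by (auto simp: p_def rot_eq N)
  have Xp: "X p = m - 2" "X (2 * m - 1) = m - 1" "X (2 * m) = 2 * m + 2"
    using assms(2) by (auto simp: X p_def)
  \<comment> \<open>A closed set for the diagram with the side \<open>2 * m - 1\<close> unglued. It
    contains \<open>2 * m + 2\<close> but not \<open>p\<close>, which is what
    \<open>step_join_around\<close> asks for.\<close>
  let ?S = "{x. x < m \<and> even x \<or> m < x \<and> x < 2 * m \<and> odd x \<or> 2 * m \<le> x \<and> x < 2 * m + 4}"
  have "orbit (?f \<circ> transpose (2 * m - 1) (m - 1)) (2 * m + 2) \<subseteq> ?S"
  proof (rule orbit_subset_closed)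
    show "2 * m + 2 \<in> ?S" by simp
  next
    fix y assume y: "y \<in> ?S"
    consider "y = 2 * m" | "y = 2 * m + 1" | "y = 2 * m + 2" | "y = 2 * m + 3" | "y < m" "even y"
      | "m < y" "y < 2 * m - 1" "odd y" | "y = 2 * m - 1"
      using y by fastforce
    then show "(?f \<circ> transpose (2 * m - 1) (m - 1)) y \<in> ?S"
    proof cases
      case 5
      then have "y + 1 < m" using assms(1) by presburger
      then show ?thesis using 5 assms by (auto simp: fX)
    next
      case 6
      then show ?thesis using assms by (auto simp: fX)
    qed (use assms in \<open>auto simp: fX\<close>)
  qed
  moreover have "p \<notin> ?S" using assms by (auto simp: p_def)
  ultimately have "p \<notin> orbit (?f \<circ> transpose (2 * m - 1) (m - 1)) (2 * m + 2)" by blast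
  then have "2 * m + 2 \<notin> orbit (?f \<circ> transpose (2 * m - 1) (m - 1)) p"
    using orbit_sym[OF permutation_transpose_comp[OF vertex_perm_permutation[OF mX]]] by blast
  moreover have "X p \<noteq> 2 * m" using Xp assms(2) by auto
  ultimately have st1: "step n X (join X p (2 * m))" and s1: "swappable n X p (2 * m)"
    using step_join_around[OF mX VX n2 p(1)] by (simp_all only: p(2,3) Xp simp_thms)
  define Y where "Y = join X p (2 * m)"
  have mY: "matching n Y" using step_matching[OF st1] by (simp add: Y_def)
  note Y = join_apply[OF mX s1, folded Y_def]
  have Y1: "Y p = rot n (rot n p)" unfolding p(2,3) Y by simp
  have Y2: "Y (2 * m - 1) = m - 1" "Y (2 * m + 1) = 2 * m + 3"
  proof -
    have "2 * m - 1 \<noteq> p" "2 * m - 1 \<noteq> 2 * m" "2 * m - 1 \<noteq> m - 2" "2 * m - 1 \<noteq> 2 * m + 2"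
      "2 * m + 1 \<noteq> p" "2 * m + 1 \<noteq> 2 * m" "2 * m + 1 \<noteq> m - 2" "2 * m + 1 \<noteq> 2 * m + 2"
      using assms(2) unfolding p_def by linarith+
    moreover have "X (2 * m + 1) = 2 * m + 3" by (simp add: X)
    ultimately show "Y (2 * m - 1) = m - 1" "Y (2 * m + 1) = 2 * m + 3"
      unfolding Y Xp by (simp_all only: if_False simp_thms Xp)
  qed
  have rm: "rot n (m - 1) = m" using assms(2) by (simp add: rot_eq N)
  have rk: "(rot n ^^ i) m = m + i" if "i < m" for i
    using that by (simp add: rot_funpow N)
  \<comment> \<open>The far end has to travel from \<open>m - 1\<close> over the sides from
    \<open>m\<close> to \<open>2 * m - 3\<close>; the chord from \<open>2 * m + 1\<close> to
    \<open>2 * m + 3\<close> is not touched.\<close>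
  have "(rot n ^^ (m - 2)) m = p" using rk[of "m - 2"] assms(2) by (simp add: p_def)
  then obtain \<beta> t where b: "reach n Y \<beta>" "t < 2 * n" "rot n t = p" "handle n \<beta> t"
    and bu: "\<forall>u. u \<noteq> 2 * m - 1 \<and> u \<noteq> m - 1 \<and>
        (\<forall>i<m - 2. u \<noteq> (rot n ^^ i) m \<and> Y u \<noteq> (rot n ^^ i) m) \<longrightarrow> \<beta> u = Y u"
    using reach_handle_from_short_chord[OF mY p(1) Y1, of "m - 2"] unfolding p(2) Y2 rm by blast
  have t: "t = 2 * m - 3"
    using b(2,3) assms(2) by (auto simp: rot_eq N p_def split: if_splits)
  have "\<beta> (2 * m + 1) = Y (2 * m + 1)"
  proof (rule bu[THEN spec, THEN mp], intro conjI allI impI)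
    fix i assume i: "i < m - 2"
    then have "(rot n ^^ i) m = m + i" using rk by simp
    then show "2 * m + 1 \<noteq> (rot n ^^ i) m" "Y (2 * m + 1) \<noteq> (rot n ^^ i) m"
      using i unfolding Y2 by linarith+
  qed (use assms(2) in linarith)+
  then have b1: "\<beta> (2 * m + 1) = 2 * m + 3" by (simp only: Y2)
  have mb: "matching n \<beta>" by (rule reach_matching[OF b(1) mY])
  have R: "rot n (2 * m - 3) = 2 * m - 2" "rot n (2 * m - 2) = 2 * m - 1" "rot n (2 * m - 1) = 2 * m"
    "rot n (2 * m) = 2 * m + 1" "rot n (2 * m + 1) = 2 * m + 2" "rot n (2 * m + 2) = 2 * m + 3"
    using assms(2) by (auto simp: rot_eq N)
  have lt: "2 * m - 3 < 2 * n" "2 * m - 2 < 2 * n" "2 * m - 1 < 2 * n" by (simp_all add: N)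
  \<comment> \<open>Three slides bring the handle from \<open>2 * m - 3\<close> to
    \<open>2 * m\<close>. Each side it jumps over drops back four places, so the chord from
    \<open>2 * m + 1\<close> to \<open>2 * m + 3\<close> ends up between \<open>2 * m - 3\<close>
    and \<open>2 * m - 1\<close>.\<close>
  define \<beta>1 where "\<beta>1 = join \<beta> (2 * m - 1) (2 * m + 1)"
  note h1 = step_slide_handle[OF mb n3 lt(1) b(4)[unfolded t], unfolded R, folded \<beta>1_def]
  have m1': "matching n \<beta>1" using h1(1) by (rule step_matching)
  have c1: "\<beta>1 (2 * m - 3) = 2 * m + 3" using h1(4) b1 by simp
  define \<beta>2 where "\<beta>2 = join \<beta>1 (2 * m) (2 * m + 2)"
  note h2 = step_slide_handle[OF m1' n3 lt(2) h1(3), unfolded R, folded \<beta>2_def]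
  have m2': "matching n \<beta>2" using h2(1) by (rule step_matching)
  have "\<beta>1 (2 * m) = 2 * m - 2"
    using h1(3) matchingD(3)[OF m1', of "2 * m - 2"] unfolding handle_def R by simp
  moreover have "\<beta>1 (2 * m + 2) \<noteq> 2 * m - 3"
    using c1 matchingD(3)[OF m1', of "2 * m + 2"] by auto
  ultimately have c2: "\<beta>2 (2 * m - 3) = 2 * m + 3"
    unfolding \<beta>2_def join_apply[OF m1' h2(2)] using c1 assms(2) by auto
  then have c2': "\<beta>2 (2 * m + 3) = 2 * m - 3" using matchingD(3)[OF m2', of "2 * m - 3"] by simp
  define \<beta>3 where "\<beta>3 = join \<beta>2 (2 * m + 1) (2 * m + 3)"
  note h3 = step_slide_handle[OF m2' n3 lt(3) h2(3), unfolded R, folded \<beta>3_def]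
  have m3': "matching n \<beta>3" using h3(1) by (rule step_matching)
  have c3: "\<beta>3 (2 * m - 1) = 2 * m - 3" using h3(4) c2' by simp
  have "reach n X Y" using st1 by (simp add: Y_def)
  then have r: "reach n X \<beta>3"
    using b(1) h1(1) h2(1) h3(1) by (meson reach_step reach_trans)
  obtain \<gamma> where g: "matching m \<gamma>" "\<beta>3 = add_handle m \<gamma>"
    using remove_handle m3' h3(3) unfolding n_def by blast
  have "\<gamma> (2 * m - 1) = 2 * m - 3" 
    using c3 assms(2) unfolding g(2) add_handle_apply[OF g(1)] by (auto split: if_splits)
  moreover have "bolza_map m (2 * m - 1) = m - 1" using assms(2) by (auto simp: bolza_map_eq)
  ultimately have "\<gamma> \<noteq> bolza_map m" using assms(2) by auto
  then show thesis using that g r by (simp add: n_def X_def)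
qed

section \<open>Connectivity by induction on the number of chords\<close>

lemma matching_1_unique:
  assumes "matching 1 \<alpha>" "matching 1 \<beta>"
  shows "\<alpha> = \<beta>"
proof -
  have *: "\<gamma> 0 = 1" "\<gamma> 1 = 0" if "matching 1 \<gamma>" for \<gamma>
    using matchingD(2,4)[OF that, of 0] matchingD(2,4)[OF that, of 1] by simp_all
  show ?thesis
  proof
    fix x :: nat
    consider "x = 0" | "x = 1" | "x \<ge> 2 * 1" by linarith
    then show "\<alpha> x = \<beta> x"
      using *[OF assms(1)] *[OF assms(2)] matchingD(6)[OF assms(1)] matchingD(6)[OF assms(2)]
      by cases simp_all
  qed
qed

text \<open>The parity hypothesis expresses that the genus is an integer; it survives deletions and
  makes \<open>n\<close> even when there is one vertex. A deletion may leave the Bolza diagram,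
  which the inductive hypothesis excludes at one vertex; hence the detours called
  \<open>escape\<close> in the proof.\<close>

lemma matchings_connected:
  assumes "matching n \<alpha>" "matching n \<beta>" "n \<ge> 1"
    and "num_vertices n \<alpha> = num_vertices n \<beta>" "odd (n + num_vertices n \<alpha>)"
    and "num_vertices n \<alpha> = 1 \<Longrightarrow> \<alpha> \<noteq> bolza_map n \<and> \<beta> \<noteq> bolza_map n"
  shows "reach n \<alpha> \<beta>"
  using assms
proof (induction n arbitrary: \<alpha> \<beta> rule: less_induct)
  case (less n)
  show ?case
  proof (cases "num_vertices n \<alpha> = 1")
    case False
    show ?thesis
    proof (cases "n = 1")
      case True
      then show ?thesis using matching_1_unique less.prems(1,2) by auto
    next
      case n1: False
      define m where "m = n - 1"
      have n: "n = m + 1" and m: "m \<ge> 1" using less.prems(3) n1 by (simp_all add: m_def)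
      have escape: "\<exists>\<gamma>'. matching m \<gamma>' \<and> reach n (add_leaf m \<gamma>) (add_leaf m \<gamma>') \<and>
          \<gamma>' \<noteq> bolza_map m" if "even m" "m \<ge> 4" "matching m \<gamma>" for \<gamma>
      proof (cases "\<gamma> = bolza_map m")
        case True
        then show ?thesis using bolza_leaf_escape[OF that(1,2)] unfolding n by metis
      qed (use that(3) in blast)
      obtain \<alpha>' where a: "matching m \<alpha>'" "reach n \<alpha> (add_leaf m \<alpha>')" "num_vertices n \<alpha> = num_vertices m \<alpha>' + 1"
        using reach_add_leaf_form[of m \<alpha>] less.prems(1) False m unfolding n by blast
      obtain \<beta>' where b: "matching m \<beta>'" "reach n \<beta> (add_leaf m \<beta>')" "num_vertices n \<beta> = num_vertices m \<beta>' + 1"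
        using reach_add_leaf_form[of m \<beta>] less.prems(2,4) False m unfolding n by metis
      have odd: "odd (m + num_vertices m \<alpha>')" using less.prems(5) a(3) by (simp add: n)
      have eq: "num_vertices m \<alpha>' = num_vertices m \<beta>'" using a(3) b(3) less.prems(4) by simp
      have lt: "m < n" by (simp add: n)
      have lift: "reach n (add_leaf m \<gamma>) (add_leaf m \<delta>)" if "reach m \<gamma> \<delta>" for \<gamma> \<delta>
        unfolding n using that m by (rule reach_add_leaf)
      have "reach n (add_leaf m \<alpha>') (add_leaf m \<beta>')"
      proof (cases "num_vertices m \<alpha>' = 1")
        case one: True
        then have "even m" using odd by simp
        show ?thesis
        proof (cases "m = 2")
          case True
          then show ?thesis
            using two_chords_one_vertex a(1) b(1) one eq by (metis rtranclp.rtrancl_refl)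
        next
          case False
          then have m4: "m \<ge> 4" using m \<open>even m\<close> by presburger
          obtain \<alpha>'' where a': "matching m \<alpha>''" "reach n (add_leaf m \<alpha>') (add_leaf m \<alpha>'')" "\<alpha>'' \<noteq> bolza_map m"
            using escape[OF \<open>even m\<close> m4 a(1)] by blast
          obtain \<beta>'' where b': "matching m \<beta>''" "reach n (add_leaf m \<beta>') (add_leaf m \<beta>'')" "\<beta>'' \<noteq> bolza_map m"
            using escape[OF \<open>even m\<close> m4 b(1)] by blast
          have "num_vertices m \<alpha>'' = 1" "num_vertices m \<beta>'' = 1"
            using reach_num_vertices[OF a'(2)] reach_num_vertices[OF b'(2)] one eq
              num_vertices_add_leaf m a(1) b(1) a'(1) b'(1) unfolding n by simp_all
          then have "reach m \<alpha>'' \<beta>''"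
            using less.IH[OF lt a'(1) b'(1) m] a'(3) b'(3) \<open>even m\<close> by simp
          then show ?thesis
            using reach_trans[OF reach_trans[OF a'(2) lift] reach_sym[OF b'(2)]] by blast
        qed
      next
        case False
        then show ?thesis using lift less.IH[OF lt a(1) b(1) m eq odd] by blast
      qed
      then show ?thesis using reach_trans[OF reach_trans[OF a(2)] reach_sym[OF b(2)]] by blast
    qed
  next
    case True
    then have "even n" using less.prems(5) by simp
    have nb: "\<alpha> \<noteq> bolza_map n" "\<beta> \<noteq> bolza_map n" using less.prems(6)[OF True] by auto
    have "n \<noteq> 2" using two_chords_one_vertex less.prems(1) True nb(1) by blast
    then have n4: "n \<ge> 4" using \<open>even n\<close> less.prems(3) by presburger
    define m where "m = n - 2"
    have n: "n = m + 2" and m: "m \<ge> 1" and "even m" using n4 \<open>even n\<close> by (simp_all add: m_def)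
    have lt: "m < n" by (simp add: n)
    have escape: "\<exists>\<gamma>'. matching m \<gamma>' \<and> reach n (add_handle m \<gamma>) (add_handle m \<gamma>') \<and>
        \<gamma>' \<noteq> bolza_map m" if "m \<ge> 4" "matching m \<gamma>" for \<gamma>
    proof (cases "\<gamma> = bolza_map m")
      case True
      then show ?thesis using bolza_handle_escape[OF \<open>even m\<close> that(1)] unfolding n by metis
    qed (use that(2) in blast)
    obtain \<alpha>' where a: "matching m \<alpha>'" "reach n \<alpha> (add_handle m \<alpha>')" "num_vertices m \<alpha>' = 1"
      using reach_add_handle_form[of m \<alpha>] less.prems(1) True nb(1) m \<open>even m\<close> unfolding n by blast
    have "num_vertices n \<beta> = 1" using True less.prems(4) by simp
    then obtain \<beta>' where b: "matching m \<beta>'" "reach n \<beta> (add_handle m \<beta>')" "num_vertices m \<beta>' = 1"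
      using reach_add_handle_form[of m \<beta>] less.prems(2) nb(2) m \<open>even m\<close> unfolding n by blast
    have lift: "reach n (add_handle m \<gamma>) (add_handle m \<delta>)" if "reach m \<gamma> \<delta>" for \<gamma> \<delta>
      unfolding n using that m by (rule reach_add_handle)
    have "reach n (add_handle m \<alpha>') (add_handle m \<beta>')"
    proof (cases "m = 2")
      case True
      then show ?thesis
        using two_chords_one_vertex a(1,3) b(1,3) by (metis rtranclp.rtrancl_refl)
    next
      case False
      then have m4: "m \<ge> 4" using m \<open>even m\<close> by presburger
      obtain \<alpha>'' where a': "matching m \<alpha>''" "reach n (add_handle m \<alpha>') (add_handle m \<alpha>'')" "\<alpha>'' \<noteq> bolza_map m"
        using escape[OF m4 a(1)] by blast
      obtain \<beta>'' where b': "matching m \<beta>''" "reach n (add_handle m \<beta>') (add_handle m \<beta>'')" "\<beta>'' \<noteq> bolza_map m"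
        using escape[OF m4 b(1)] by blast
      have "num_vertices m \<alpha>'' = 1" "num_vertices m \<beta>'' = 1"
        using reach_num_vertices[OF a'(2)] reach_num_vertices[OF b'(2)] a(3) b(3)
        unfolding n num_vertices_add_handle[OF a(1) m] num_vertices_add_handle[OF b(1) m]
          num_vertices_add_handle[OF a'(1) m] num_vertices_add_handle[OF b'(1) m] by simp_all
      then have "reach m \<alpha>'' \<beta>''"
        using less.IH[OF lt a'(1) b'(1) m] a'(3) b'(3) \<open>even m\<close> by simp
      then show ?thesis
        using reach_trans[OF reach_trans[OF a'(2) lift] reach_sym[OF b'(2)]] by blast
    qed
    then show ?thesis using reach_trans[OF reach_trans[OF a(2)] reach_sym[OF b(2)]] by blast
  qed
qed

section \<open>Chord diagrams as matchings\<close>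

definition diagram_of :: "nat \<Rightarrow> (nat \<Rightarrow> nat) \<Rightarrow> diagram" where
  "diagram_of n \<alpha> = {{x, \<alpha> x} | x. x < 2 * n}"

lemma diagram_of_iff:
  assumes "matching n \<alpha>"
  shows "{a, b} \<in> diagram_of n \<alpha> \<longleftrightarrow> a < 2 * n \<and> b = \<alpha> a"
proof
  assume "{a, b} \<in> diagram_of n \<alpha>"
  then obtain x where "x < 2 * n" "{a, b} = {x, \<alpha> x}" by (auto simp: diagram_of_def)
  then show "a < 2 * n \<and> b = \<alpha> a"
    using matchingD(3,4)[OF assms] by (auto simp: doubleton_eq_iff)
qed (auto simp: diagram_of_def)

lemma diagram_of_inj:
  assumes "matching n \<alpha>" "matching n \<beta>" "diagram_of n \<alpha> = diagram_of n \<beta>"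
  shows "\<alpha> = \<beta>"
proof
  fix x
  show "\<alpha> x = \<beta> x"
  proof (cases "x < 2 * n")
    case True
    then have "{x, \<alpha> x} \<in> diagram_of n \<beta>" using diagram_of_iff[OF assms(1)] assms(3) by simp
    then show ?thesis using diagram_of_iff[OF assms(2)] by simp
  qed (simp add: matchingD(6)[OF assms(1)] matchingD(6)[OF assms(2)])
qed

lemma chord_diagram_diagram_of:
  assumes "matching n \<alpha>"
  shows "chord_diagram n (diagram_of n \<alpha>)"
  unfolding chord_diagram_def
proof (intro conjI ballI)
  let ?X = "diagram_of n \<alpha>"
  note D = matchingD[OF assms]
  show chord: "chord n c" if c: "c \<in> ?X" for c
  proof -
    obtain x where "x < 2 * n" "c = {x, \<alpha> x}" using c by (auto simp: diagram_of_def)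
    then show ?thesis using D(2)[of x] D(4)[of x] by (auto simp: chord_def polygon_def)
  qed
  show uniq: "\<exists>!c. c \<in> ?X \<and> s \<in> c" if "s \<in> polygon n" for s
  proof (rule ex1I[of _ "{s, \<alpha> s}"])
    have "s < 2 * n" using that by (simp add: polygon_def)
    then show "{s, \<alpha> s} \<in> ?X \<and> s \<in> {s, \<alpha> s}" by (auto simp: diagram_of_def)
  next
    fix c assume "c \<in> ?X \<and> s \<in> c"
    then show "c = {s, \<alpha> s}" using D(3) by (auto simp: diagram_of_def)
  qed
  have "2 * card ?X = card (\<Union> ?X)"
  proof (rule card_partition)
    show "finite ?X" unfolding diagram_of_def by simp
    show "finite (\<Union> ?X)" by (auto simp: diagram_of_def)
    show "card c = 2" if "c \<in> ?X" for c using chord[OF that] by (simp add: chord_def)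
    show "c1 \<inter> c2 = {}" if "c1 \<in> ?X" "c2 \<in> ?X" "c1 \<noteq> c2" for c1 c2
      using that uniq chord unfolding chord_def by (metis disjoint_iff subsetD)
  qed
  also have "\<Union> ?X = {..<2 * n}" using D(4) by (auto simp: diagram_of_def)
  finally show "card ?X = n" by simp
qed

lemma chord_diagram_matching:
  assumes "chord_diagram n X"
  obtains \<alpha> where "matching n \<alpha>" "X = diagram_of n \<alpha>"
proof -
  have ch: "chord n c" if "c \<in> X" for c using assms that by (simp add: chord_diagram_def)
  have uniq: "c = c'" if "c \<in> X" "c' \<in> X" "s \<in> c" "s \<in> c'" for c c' s
  proof -
    have "s \<in> polygon n" using ch[OF that(1)] that(3) by (auto simp: chord_def)
    then show ?thesis using assms that unfolding chord_diagram_def by blast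
  qed
  have "\<exists>t. {s, t} \<in> X \<and> t \<noteq> s \<and> t < 2 * n" if "s < 2 * n" for s
  proof -
    have "s \<in> polygon n" using that by (simp add: polygon_def)
    then obtain c where c: "c \<in> X" "s \<in> c" using assms by (auto simp: chord_diagram_def)
    then obtain a b where "c = {a, b}" "a \<noteq> b" "c \<subseteq> polygon n"
      using ch[OF c(1)] by (auto simp: chord_def card_2_iff)
    then show ?thesis using c by (auto simp: polygon_def insert_commute)
  qed
  then obtain \<alpha>0 where a0: "\<And>s. s < 2 * n \<Longrightarrow> {s, \<alpha>0 s} \<in> X \<and> \<alpha>0 s \<noteq> s \<and> \<alpha>0 s < 2 * n" by metis
  define \<alpha> where "\<alpha> s = (if s < 2 * n then \<alpha>0 s else s)" for s
  have a: "{s, \<alpha> s} \<in> X" "\<alpha> s \<noteq> s" "\<alpha> s < 2 * n" if "s < 2 * n" for s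
    using a0[OF that] that by (simp_all add: \<alpha>_def)
  have inv: "\<alpha> (\<alpha> s) = s" if "s < 2 * n" for s
  proof -
    have "{s, \<alpha> s} = {\<alpha> s, \<alpha> (\<alpha> s)}"
      by (rule uniq[of _ _ "\<alpha> s"]) (use a[OF that] a[OF a(3)[OF that]] in auto)
    then show ?thesis by (auto simp: doubleton_eq_iff)
  qed
  have m: "matching n \<alpha>" by (rule matchingI) (use a inv in \<open>auto simp: \<alpha>_def\<close>)
  have "X = diagram_of n \<alpha>"
  proof (intro set_eqI iffI)
    fix c assume c: "c \<in> X"
    then obtain s t where st: "c = {s, t}" "s < 2 * n"
      using ch[OF c] by (auto simp: chord_def card_2_iff polygon_def)
    have "c = {s, \<alpha> s}" by (rule uniq[of _ _ s]) (use c st a in auto)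
    then show "c \<in> diagram_of n \<alpha>" using st by (auto simp: diagram_of_def)
  qed (use a in \<open>auto simp: diagram_of_def\<close>)
  then show thesis using that m by blast
qed

text \<open>The gluing relation is the graph of the vertex permutation. On a finite set inverse
  steps are iterates of forward steps, so the symmetric closure has the orbits as its
  classes.\<close>

lemma card_vertex_classes:
  assumes "matching n \<alpha>"
  shows "card (vertex_classes n (diagram_of n \<alpha>)) = num_vertices n \<alpha>"
proof -
  let ?f = "vertex_perm n \<alpha>"
  define G where "G = vertex_gluing n (diagram_of n \<alpha>)"
  have pf: "permutation ?f" by (rule vertex_perm_permutation) fact
  have G: "(a, b) \<in> G \<longleftrightarrow> a < 2 * n \<and> b = ?f a" for a b
    by (auto simp: G_def vertex_gluing_def diagram_of_iff[OF assms] vertex_perm_apply rot_def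
        matchingD(4)[OF assms])
  have "(G \<union> G\<inverse>)\<^sup>* `` {x} = orbit ?f x" if x: "x < 2 * n" for x
  proof (intro set_eqI iffI)
    fix y assume "y \<in> (G \<union> G\<inverse>)\<^sup>* `` {x}"
    then have "(x, y) \<in> (G \<union> G\<inverse>)\<^sup>*" by simp
    then show "y \<in> orbit ?f x"
    proof induction
      case base
      show ?case by (rule permutation_self_in_orbit[OF pf])
    next
      case (step y z)
      then consider "z = ?f y" | "y = ?f z" using G by auto
      then show ?case
      proof cases
        case 1
        then show ?thesis using step.IH by (simp add: orbit.step)
      next
        case 2
        have "z \<in> orbit ?f y" unfolding 2 by (rule orbit_sym[OF pf orbit.base])
        then show ?thesis using step.IH by (rule orbit_trans)
      qed
    qed
  next
    fix y assume "y \<in> orbit ?f x"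
    then have "(x, y) \<in> (G \<union> G\<inverse>)\<^sup>* \<and> y < 2 * n"
    proof induction
      case base
      have "(x, ?f x) \<in> G" using x G by simp
      then show ?case using x by (auto simp: vertex_perm_apply matchingD(4)[OF assms])
    next
      case (step y)
      then have "(y, ?f y) \<in> G \<union> G\<inverse>" using G by simp
      with step.IH show ?case
        by (auto simp: vertex_perm_apply matchingD(4)[OF assms] intro: rtrancl_into_rtrancl)
    qed
    then show "y \<in> (G \<union> G\<inverse>)\<^sup>* `` {x}" by simp
  qed
  then have "vertex_classes n (diagram_of n \<alpha>) = orbit ?f ` {..<2 * n}"
    unfolding vertex_classes_def G_def[symmetric] quotient_def polygon_def by auto
  then show ?thesis by (simp add: num_vertices_def num_cycles_def)
qed

lemma diagram_of_join:
  assumes "matching n \<alpha>" "swappable n \<alpha> p r"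
  shows "diagram_of n (join \<alpha> p r)
    = (diagram_of n \<alpha> - {{p, \<alpha> p}, {r, \<alpha> r}}) \<union> {{p, r}, {\<alpha> p, \<alpha> r}}"
proof (intro set_eqI iffI)
  note d = swappable_distinct[OF assms] and j = join_apply[OF assms]
  fix c
  {
    assume "c \<in> diagram_of n (join \<alpha> p r)"
    then obtain x where x: "x < 2 * n" "c = {x, join \<alpha> p r x}" by (auto simp: diagram_of_def)
    show "c \<in> (diagram_of n \<alpha> - {{p, \<alpha> p}, {r, \<alpha> r}}) \<union> {{p, r}, {\<alpha> p, \<alpha> r}}"
    proof (cases "x \<in> {p, r, \<alpha> p, \<alpha> r}")
      case True
      then have "c = {p, r} \<or> c = {\<alpha> p, \<alpha> r}"
        unfolding x(2) by (elim insertE emptyE) (simp_all add: j d insert_commute)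
      then show ?thesis by blast
    next
      case False
      then have "c = {x, \<alpha> x}" using x(2) by (simp add: j)
      moreover have "c \<noteq> {p, \<alpha> p}" "c \<noteq> {r, \<alpha> r}" using False x(2) by blast+
      moreover have "{x, \<alpha> x} \<in> diagram_of n \<alpha>" using x(1) by (auto simp: diagram_of_def)
      ultimately show ?thesis by simp
    qed
  next
    assume "c \<in> (diagram_of n \<alpha> - {{p, \<alpha> p}, {r, \<alpha> r}}) \<union> {{p, r}, {\<alpha> p, \<alpha> r}}"
    then consider "c \<in> diagram_of n \<alpha>" "c \<noteq> {p, \<alpha> p}" "c \<noteq> {r, \<alpha> r}" | "c = {p, r}" | "c = {\<alpha> p, \<alpha> r}"
      by blast
    then show "c \<in> diagram_of n (join \<alpha> p r)"
    proof cases
      case 1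
      then obtain x where x: "x < 2 * n" "c = {x, \<alpha> x}" by (auto simp: diagram_of_def)
      have "x \<noteq> p" "x \<noteq> r" using 1(2,3) x(2) by blast+
      moreover have "x \<noteq> \<alpha> p" "x \<noteq> \<alpha> r"
        using 1(2,3) x(2) matchingD(3)[OF assms(1)] insert_commute by metis+
      ultimately have "c = {x, join \<alpha> p r x}" using x by (simp add: j)
      then show ?thesis using x(1) by (auto simp: diagram_of_def)
    next
      case 2
      then have "c = {p, join \<alpha> p r p}" by (simp add: j)
      then show ?thesis using d(1) by (auto simp: diagram_of_def)
    next
      case 3
      then have "c = {\<alpha> p, join \<alpha> p r (\<alpha> p)}" using d by (simp add: j)
      then show ?thesis using d(3) by (auto simp: diagram_of_def)
    qed
  }
qed

lemma chord_swap_join: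
  assumes "matching n \<alpha>" "swappable n \<alpha> p r"
  shows "chord_swap (diagram_of n \<alpha>) (diagram_of n (join \<alpha> p r))"
  unfolding chord_swap_def
proof (intro exI conjI disjI1)
  note d = swappable_distinct[OF assms]
  show "{p, \<alpha> p} \<in> diagram_of n \<alpha>" "{r, \<alpha> r} \<in> diagram_of n \<alpha>"
    using d by (simp_all add: diagram_of_iff[OF assms(1)])
  show "{p, \<alpha> p} \<noteq> {r, \<alpha> r}" using d by (simp add: doubleton_eq_iff)
  show "diagram_of n (join \<alpha> p r)
      = (diagram_of n \<alpha> - {{p, \<alpha> p}, {r, \<alpha> r}}) \<union> {{p, r}, {\<alpha> p, \<alpha> r}}"
    by (rule diagram_of_join) fact+
qed

lemma chord_swap_imp_join:
  assumes "matching n \<alpha>" "chord_swap (diagram_of n \<alpha>) Y"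
  obtains p r where "swappable n \<alpha> p r" "Y = diagram_of n (join \<alpha> p r)"
proof -
  obtain a c where ac: "a < 2 * n" "c < 2 * n" "{a, \<alpha> a} \<noteq> {c, \<alpha> c}"
    and Y: "Y = (diagram_of n \<alpha> - {{a, \<alpha> a}, {c, \<alpha> c}}) \<union> {{a, c}, {\<alpha> a, \<alpha> c}} \<or>
         Y = (diagram_of n \<alpha> - {{a, \<alpha> a}, {c, \<alpha> c}}) \<union> {{a, \<alpha> c}, {\<alpha> a, c}}"
  proof -
    obtain a b c d where *: "{a, b} \<in> diagram_of n \<alpha>" "{c, d} \<in> diagram_of n \<alpha>" "{a, b} \<noteq> {c, d}"
      "Y = (diagram_of n \<alpha> - {{a, b}, {c, d}}) \<union> {{a, c}, {b, d}} \<or>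
       Y = (diagram_of n \<alpha> - {{a, b}, {c, d}}) \<union> {{a, d}, {b, c}}"
      using assms(2) unfolding chord_swap_def by (elim exE conjE)
    from *(1,2) have "a < 2 * n" "c < 2 * n" "b = \<alpha> a" "d = \<alpha> c"
      by (simp_all add: diagram_of_iff[OF assms(1)])
    then show thesis using that[of a c] *(3,4) by simp
  qed
  have inv: "\<alpha> (\<alpha> x) = x" for x by (rule matchingD(3)[OF assms(1)])
  have ne: "c \<noteq> a" "c \<noteq> \<alpha> a" using ac(3) inv[of a] by (auto simp: insert_commute)
  have s1: "swappable n \<alpha> a c" using ac ne by (simp add: swappable_def)
  \<comment> \<open>The other re-pairing is the same operation with the other end
    \<open>\<alpha> c\<close>.\<close>
  have s2: "swappable n \<alpha> a (\<alpha> c)"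
  proof -
    have "\<alpha> c \<noteq> a" using ne(2) inv[of c] by metis
    moreover have "\<alpha> c \<noteq> \<alpha> a" using ne(1) matchingD(5)[OF assms(1)] by simp
    moreover have "\<alpha> c < 2 * n" using ac(2) matchingD(4)[OF assms(1)] by simp
    ultimately show ?thesis using ac(1) by (simp add: swappable_def)
  qed
  from Y show thesis
  proof
    assume "Y = (diagram_of n \<alpha> - {{a, \<alpha> a}, {c, \<alpha> c}}) \<union> {{a, c}, {\<alpha> a, \<alpha> c}}"
    then show ?thesis using that[OF s1] diagram_of_join[OF assms(1) s1] by simp
  next
    assume "Y = (diagram_of n \<alpha> - {{a, \<alpha> a}, {c, \<alpha> c}}) \<union> {{a, \<alpha> c}, {\<alpha> a, c}}"
    then show ?thesis using that[OF s2] diagram_of_join[OF assms(1) s2] by (simp add: inv insert_commute)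
  qed
qed

lemma bolza_diagram_of: "bolza n = diagram_of n (bolza_map n)"
proof (intro set_eqI iffI)
  fix c assume "c \<in> bolza n"
  then obtain x where "x < n" "c = {x, x + n}" by (auto simp: bolza_def)
  then have "x < 2 * n" "c = {x, bolza_map n x}" by (simp_all add: bolza_map_eq)
  then show "c \<in> diagram_of n (bolza_map n)" by (auto simp: diagram_of_def)
next
  fix c assume "c \<in> diagram_of n (bolza_map n)"
  then obtain x where x: "x < 2 * n" "c = {x, bolza_map n x}" by (auto simp: diagram_of_def)
  show "c \<in> bolza n"
  proof (cases "x < n")
    case True
    then show ?thesis using x by (auto simp: bolza_def bolza_map_eq)
  next
    case False
    then have "x - n < n" "c = {x - n, x - n + n}" using x by (auto simp: bolza_map_eq)
    then show ?thesis unfolding bolza_def by blast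
  qed
qed

section \<open>Swaps out of the Bolza diagram\<close>

lemma funpow_transpose_avoid:
  assumes "\<And>i. i < k \<Longrightarrow> (f ^^ i) x \<noteq> r \<and> (f ^^ i) x \<noteq> q"
  shows "((f \<circ> transpose r q) ^^ k) x = (f ^^ k) x"
  using assms by (induction k) auto

text \<open>In the order around the vertex all chords are half turns, so any two cross. Let
  \<open>r\<close> come \<open>j\<close> places after \<open>p\<close>. The first transposition
  splits the cycle, and for \<open>j < n\<close> as for \<open>j > n\<close> the vertices
  \<open>p\<close> and \<open>\<alpha> r\<close> stay on the same part; so the second splits too,
  leaving three vertices.\<close>

lemma bolza_join_not_one_vertex:
  assumes "even n" "swappable n (bolza_map n) p r"
  shows "num_vertices n (join (bolza_map n) p r) \<noteq> 1"
proof -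
  have p: "p < 2 * n" "r < 2 * n" using assms(2) by (simp_all add: swappable_def)
  then have n: "n \<ge> 1" by simp
  note bm = bolza_matching[OF n]
  let ?\<alpha> = "bolza_map n" and ?f = "vertex_perm n (bolza_map n)" and ?A = "{..<2 * n}"
  note d = swappable_distinct[OF bm assms(2)]
  have f: "?f permutes ?A" by (rule vertex_perm_permutes) fact
  have pf: "permutation ?f" by (rule vertex_perm_permutation) fact
  have fc: "(?f ^^ (2 * n)) p = p" "inj_on (\<lambda>k. (?f ^^ k) p) ?A" "?A = (\<lambda>k. (?f ^^ k) p) ` ?A"
    using funpow_full_cycle[of ?A ?f p] bolza_orbit[OF assms(1)] permutes_orbit_subset[OF f] p by simp_all
  obtain h where h: "n = 2 * h" using assms(1) by blast
  have an: "?\<alpha> x = (?f ^^ n) x" if "x < 2 * n" for x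
  proof -
    have e: "x + n * (n + 1) = x + n + 2 * n * h" by (simp add: h algebra_simps)
    have "(?f ^^ n) x = (x + n) mod (2 * n)"
      unfolding bolza_vertex_funpow[OF assms(1) that] e by (simp only: mod_mult_self2)
    then show ?thesis using that by (simp add: bolza_map_def)
  qed
  have "r \<in> ?A" using p(2) by simp
  then have "r \<in> (\<lambda>k. (?f ^^ k) p) ` ?A" using fc(3) by (rule back_subst[of "\<lambda>S. r \<in> S"])
  then obtain j where j: "j < 2 * n" "r = (?f ^^ j) p" by auto
  have q: "?\<alpha> p = (?f ^^ n) p" using an p by simp
  have w: "?\<alpha> r = (?f ^^ (n + j)) p" using an[OF p(2)] by (simp add: j(2) funpow_add)
  have "j \<noteq> n" using d(7) j(2) q by auto
  have "j \<noteq> 0" using d(5) j(2) by (metis funpow_0)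
  have neq: "(?f ^^ i) p \<noteq> (?f ^^ k) p" if "i < 2 * n" "k < 2 * n" "i \<noteq> k" for i k
    using fc(2) that by (auto dest: inj_onD)
  let ?g = "?f \<circ> transpose r (?\<alpha> p)"
  have pg: "permutation ?g" by (rule permutation_transpose_comp[OF pf])
  have orb: "(?g ^^ k) x \<in> orbit ?g x" for k x
    by (intro funpow_in_orbit permutation_self_in_orbit pg)
  have "?\<alpha> r \<in> orbit ?g p"
  proof (cases "j < n")
    case True
    have "(?g ^^ (n - j)) (?\<alpha> r) = (?f ^^ (n - j)) (?\<alpha> r)"
    proof (rule funpow_transpose_avoid)
      fix i assume i: "i < n - j"
      have "(?f ^^ i) (?\<alpha> r) = (?f ^^ (i + (n + j))) p" by (simp add: w funpow_add)
      then show "(?f ^^ i) (?\<alpha> r) \<noteq> r \<and> (?f ^^ i) (?\<alpha> r) \<noteq> ?\<alpha> p"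
        unfolding q using i True \<open>j \<noteq> 0\<close> j(2) neq[of "i + (n + j)" j] neq[of "i + (n + j)" n]
        by simp
    qed
    also have "\<dots> = (?f ^^ (n - j + (n + j))) p" by (simp only: w funpow_add o_apply)
    also have "\<dots> = p" using fc(1) True by (simp add: mult_2)
    finally show ?thesis using orb orbit_sym[OF pg] by metis
  next
    case False
    then have jn: "j > n" using \<open>j \<noteq> n\<close> by simp
    have "(?g ^^ (j - n)) p = (?f ^^ (j - n)) p"
    proof (rule funpow_transpose_avoid)
      fix i assume "i < j - n"
      then show "(?f ^^ i) p \<noteq> r \<and> (?f ^^ i) p \<noteq> ?\<alpha> p"
        unfolding j(2) q using neq[of i j] neq[of i n] j(1) by simp
    qed
    also have "\<dots> = (?f ^^ (j - n + 2 * n)) p" using fc(1) by (simp only: funpow_add o_apply)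
    also have "j - n + 2 * n = n + j" using jn by simp
    finally show ?thesis using orb w by metis
  qed
  then have "num_cycles ?A (?g \<circ> transpose p (?\<alpha> r)) = num_cycles ?A ?g + 1"
    using f d(1-4,9) by (intro num_cycles_split permutes_compose permutes_swap_id) simp_all
  moreover have "num_cycles ?A ?g = num_cycles ?A ?f + 1"
    using f d(1-4,7) bolza_orbit[OF assms(1)] by (intro num_cycles_split) simp_all
  ultimately show ?thesis
    unfolding num_vertices_def vertex_perm_join'[OF bm assms(2)] by simp
qed

section \<open>The Markov chain\<close>

text \<open>\<open>E\<close> contains the off-diagonal support of the kernel. Waiting at a state
  only uses up time, so without an \<open>E\<close>-path of length at most \<open>t\<close> every
  term of the matrix product vanishes.\<close>

lemma kernel_pow_zero:
  assumes "\<And>k. k \<le> t \<Longrightarrow> (x, y) \<notin> E ^^ k" "x \<in> S"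
    and E: "\<And>x z. x \<in> S \<Longrightarrow> z \<in> S \<Longrightarrow> x \<noteq> z \<Longrightarrow> (x, z) \<notin> E \<Longrightarrow> P x z = 0"
  shows "kernel_pow S P t x y = 0"
  using assms(1,2)
proof (induction t arbitrary: x)
  case 0
  then show ?case using 0(1)[of 0] by simp
next
  case (Suc t)
  have "P x z * kernel_pow S P t z y = 0" if z: "z \<in> S" for z
  proof (cases "z = x \<or> (x, z) \<in> E")
    case True
    have "(z, y) \<notin> E ^^ k" if "k \<le> t" for k
      using True Suc.prems(1)[of k] Suc.prems(1)[of "Suc k"] that relpow_Suc_I2 by (metis Suc_le_mono le_SucI)
    then show ?thesis using Suc.IH z by simp
  next
    case False
    then show ?thesis using E Suc.prems(2) z by auto
  qed
  then show ?case unfolding kernel_pow.simps by (intro sum.neutral ballI)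
qed

text \<open>
  Along a shortest path no term of the matrix product uses the diagonal of the kernel, so
  nothing has to be known about the holding probabilities.
\<close>

lemma kernel_pow_pos:
  fixes P :: "'a \<Rightarrow> 'a \<Rightarrow> real"
  assumes "finite S" "(x, y) \<in> E ^^ t" "\<And>k. k < t \<Longrightarrow> (x, y) \<notin> E ^^ k" "x \<in> S"
    and E: "E \<subseteq> S \<times> S" "\<And>x z. (x, z) \<in> E \<Longrightarrow> P x z > 0"
      "\<And>x z. x \<in> S \<Longrightarrow> z \<in> S \<Longrightarrow> x \<noteq> z \<Longrightarrow> (x, z) \<notin> E \<Longrightarrow> P x z = 0"
  shows "kernel_pow S P t x y > 0"
  using assms(2-4)
proof (induction t arbitrary: x)
  case 0
  then show ?case by simp
next
  case (Suc t)
  have short: "(z, y) \<notin> E ^^ k" if "(x, z) \<in> E" "k < t" for z k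
    using Suc.prems(2)[of "Suc k"] relpow_Suc_I2[OF that(1)] that(2) by auto
  obtain z where z: "(x, z) \<in> E" "(z, y) \<in> E ^^ t" using Suc.prems(1) by (rule relpow_Suc_E2)
  have zS: "z \<in> S" using z(1) E(1) by blast
  have "0 < P x z * kernel_pow S P t z y"
    using E(2)[OF z(1)] Suc.IH[OF z(2) short[OF z(1)] zS] by simp
  moreover have "0 \<le> P x w * kernel_pow S P t w y" if w: "w \<in> S" for w
  proof (cases "w = x")
    case True
    have "kernel_pow S P t x y = 0"
      by (rule kernel_pow_zero[where E = E]) (use Suc.prems E(3) in auto)
    then show ?thesis using True by simp
  next
    case False
    show ?thesis
    proof (cases "(x, w) \<in> E")
      case True
      have "0 \<le> kernel_pow S P t w y"
      proof (cases "(w, y) \<in> E ^^ t")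
        case True
        then show ?thesis using Suc.IH[OF True short[OF \<open>(x, w) \<in> E\<close>] w] by simp
      next
        case False
        have "kernel_pow S P t w y = 0"
          by (rule kernel_pow_zero[where E = E])
            (use False short[OF \<open>(x, w) \<in> E\<close>] w E(3) in \<open>auto simp: le_less\<close>)
        then show ?thesis by simp
      qed
      then show ?thesis using E(2)[OF True] by simp
    next
      case False
      then show ?thesis using E(3) Suc.prems(3) w \<open>w \<noteq> x\<close> by auto
    qed
  qed
  ultimately show ?case unfolding kernel_pow.simps using assms(1) zS by (intro sum_pos2) auto
qed

lemma accessible_rtrancl:
  fixes P :: "'a \<Rightarrow> 'a \<Rightarrow> real"
  assumes "finite S" "x \<in> S" "(x, y) \<in> E\<^sup>*"
    and E: "E \<subseteq> S \<times> S" "\<And>x z. (x, z) \<in> E \<Longrightarrow> P x z > 0"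
      "\<And>x z. x \<in> S \<Longrightarrow> z \<in> S \<Longrightarrow> x \<noteq> z \<Longrightarrow> (x, z) \<notin> E \<Longrightarrow> P x z = 0"
  shows "accessible S P x y"
proof -
  have ex: "\<exists>t. (x, y) \<in> E ^^ t" using assms(3) by (simp add: rtrancl_is_UN_relpow)
  define t where "t = (LEAST t. (x, y) \<in> E ^^ t)"
  have "kernel_pow S P t x y > 0"
    using assms(1) LeastI_ex[OF ex] not_less_Least[of _ "\<lambda>t. (x, y) \<in> E ^^ t"] assms(2) E
    unfolding t_def by (intro kernel_pow_pos[where E = E]) auto
  then show ?thesis by (auto simp: accessible_def)
qed

lemma absorbing_not_accessible:
  fixes P :: "'a \<Rightarrow> 'a \<Rightarrow> real"
  assumes "\<And>z. z \<in> S \<Longrightarrow> z \<noteq> x \<Longrightarrow> P x z = 0" "y \<noteq> x"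
  shows "\<not> accessible S P x y"
proof -
  have "kernel_pow S P t x y = 0" for t
  proof (induction t)
    case 0
    then show ?case using assms(2) by simp
  next
    case (Suc t)
    have "P x z * kernel_pow S P t z y = 0" if "z \<in> S" for z
      using Suc assms(1)[OF that] by (cases "z = x") auto
    then show ?case unfolding kernel_pow.simps by (intro sum.neutral ballI)
  qed
  then show ?thesis by (simp add: accessible_def)
qed

section \<open>From paths of involutions to the chain of fixed genus\<close>

lemma fixed_genus_iff:
  assumes "matching n \<alpha>"
  shows "diagram_of n \<alpha> \<in> fixed_genus n g \<longleftrightarrow> n + 1 = num_vertices n \<alpha> + 2 * g"
proof -
  have "genus n (diagram_of n \<alpha>) = real g \<longleftrightarrow> real (n + 1) = real (num_vertices n \<alpha> + 2 * g)"
    by (auto simp: genus_def card_vertex_classes[OF assms] field_simps)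
  also have "\<dots> \<longleftrightarrow> n + 1 = num_vertices n \<alpha> + 2 * g" by (simp only: of_nat_eq_iff)
  finally show ?thesis using chord_diagram_diagram_of[OF assms] by (simp add: fixed_genus_def)
qed

lemma fixed_genus_matching:
  assumes "X \<in> fixed_genus n g"
  obtains \<alpha> where "matching n \<alpha>" "X = diagram_of n \<alpha>" "n + 1 = num_vertices n \<alpha> + 2 * g"
  using assms chord_diagram_matching fixed_genus_iff
  by (metis (mono_tags, lifting) fixed_genus_def mem_Collect_eq)

lemma finite_fixed_genus: "finite (fixed_genus n g)"
proof (rule finite_subset)
  show "fixed_genus n g \<subseteq> Pow (Pow (polygon n))"
    by (auto simp: fixed_genus_def chord_diagram_def chord_def)
qed (simp add: polygon_def)

lemma accessible_if_reach:
  assumes "n \<ge> 2" "matching n \<alpha>" "diagram_of n \<alpha> \<in> fixed_genus n g" "reach n \<alpha> \<beta>"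
  shows "accessible (fixed_genus n g) (swap_chain n g) (diagram_of n \<alpha>) (diagram_of n \<beta>)"
proof -
  let ?S = "fixed_genus n g" and ?P = "swap_chain n g"
  define E where "E = {(X, Y). X \<in> ?S \<and> Y \<in> ?S \<and> X \<noteq> Y \<and> chord_swap X Y}"
  have "n choose 2 > 0" using assms(1) by (simp add: zero_less_binomial_iff)
  then have pos: "?P X Y > 0" if "(X, Y) \<in> E" for X Y
    using that by (auto simp: E_def swap_chain_def swap_prob_def)
  have zero: "?P X Y = 0" if "X \<in> ?S" "Y \<in> ?S" "X \<noteq> Y" "(X, Y) \<notin> E" for X Y
    using that by (auto simp: E_def swap_chain_def swap_prob_def)
  have "(diagram_of n \<alpha>, diagram_of n \<beta>) \<in> E\<^sup>*"
    using assms(4)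
  proof induction
    case (step \<beta> \<gamma>)
    have mb: "matching n \<beta>" by (rule reach_matching[OF step(1) assms(2)])
    have mg: "matching n \<gamma>" by (rule step_matching[OF step(2)])
    have "diagram_of n \<beta> \<in> ?S"
      using assms(3) reach_num_vertices[OF step(1)]
      by (simp add: fixed_genus_iff[OF mb] fixed_genus_iff[OF assms(2)])
    moreover have "diagram_of n \<gamma> \<in> ?S"
      using calculation step(2) by (simp add: fixed_genus_iff[OF mb] fixed_genus_iff[OF mg] step_def)
    moreover have "chord_swap (diagram_of n \<beta>) (diagram_of n \<gamma>)"
      using step(2) chord_swap_join by (auto simp: step_def)
    ultimately have "diagram_of n \<beta> = diagram_of n \<gamma> \<or> (diagram_of n \<beta>, diagram_of n \<gamma>) \<in> E"
      by (auto simp: E_def)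
    then show ?case using step.IH by (metis rtrancl_into_rtrancl)
  qed simp
  then show ?thesis
    by (rule accessible_rtrancl[OF finite_fixed_genus assms(3)]) (use pos zero in \<open>auto simp: E_def\<close>)
qed

lemma bolza_swap_chain_zero:
  assumes "n = 2 * g" "n \<ge> 1" "Y \<in> fixed_genus n g" "Y \<noteq> bolza n"
  shows "swap_chain n g (bolza n) Y = 0" "swap_chain n g Y (bolza n) = 0"
proof -
  have "even n" using assms(1) by simp
  note bm = bolza_matching[OF assms(2)]
  obtain \<beta> where \<beta>: "matching n \<beta>" "Y = diagram_of n \<beta>" "n + 1 = num_vertices n \<beta> + 2 * g"
    using fixed_genus_matching[OF assms(3)] .
  then have b: "matching n \<beta>" "Y = diagram_of n \<beta>" "num_vertices n \<beta> = 1"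
    using assms(1) by simp_all
  have no: "\<not> step n (bolza_map n) \<gamma>" for \<gamma>
    using bolza_join_not_one_vertex[OF \<open>even n\<close>] bolza_one_vertex[OF \<open>even n\<close> assms(2)]
    by (auto simp: step_def)
  have "\<not> chord_swap (bolza n) Y"
  proof
    assume "chord_swap (bolza n) Y"
    then obtain p r where "swappable n (bolza_map n) p r" "Y = diagram_of n (join (bolza_map n) p r)"
      using chord_swap_imp_join[OF bm] by (metis bolza_diagram_of)
    moreover from this have "\<beta> = join (bolza_map n) p r"
      using diagram_of_inj b(1,2) join_matching[OF bm] by metis
    ultimately show False using bolza_join_not_one_vertex[OF \<open>even n\<close>] b(3) by metis
  qed
  then show "swap_chain n g (bolza n) Y = 0" using assms(4) by (auto simp: swap_chain_def swap_prob_def)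
  have "\<not> chord_swap Y (bolza n)"
  proof
    assume "chord_swap Y (bolza n)"
    then obtain p r where pr: "swappable n \<beta> p r" "bolza n = diagram_of n (join \<beta> p r)"
      using chord_swap_imp_join[OF b(1)] b(2) by metis
    then have "bolza_map n = join \<beta> p r"
      using diagram_of_inj bm bolza_diagram_of join_matching[OF b(1)] by metis
    then have "step n \<beta> (bolza_map n)"
      using pr(1) b bolza_one_vertex[OF \<open>even n\<close> assms(2)] by (auto simp: step_def)
    then show False using no step_sym by blast
  qed
  then show "swap_chain n g Y (bolza n) = 0" using assms(4) by (auto simp: swap_chain_def swap_prob_def)
qed

theorem theorem2p2:
  fixes n g :: nat
  assumes "n \<ge> 3" and "real g \<le> real n / 2"
  shows "(real g < real n / 2 \<longrightarrow> irreducible_chain (fixed_genus n g) (swap_chain n g)) \<and>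
         (real g = real n / 2 \<longrightarrow>
            card (communicating_classes (fixed_genus n g) (swap_chain n g)) = 2 \<and>
            communicating_classes (fixed_genus n g) (swap_chain n g)
              = {{bolza n}, fixed_genus n g - {bolza n}} \<and>
            isolated_state (fixed_genus n g) (swap_chain n g) (bolza n))"
proof (intro conjI impI)
  let ?S = "fixed_genus n g" and ?P = "swap_chain n g"
  have n: "n \<ge> 1" "n \<ge> 2" using assms(1) by simp_all
  have access: "accessible ?S ?P X Y"
    if X: "X \<in> ?S" and Y: "Y \<in> ?S" and nb: "n = 2 * g \<Longrightarrow> X \<noteq> bolza n \<and> Y \<noteq> bolza n" for X Y
  proof -
    obtain \<alpha> where a: "matching n \<alpha>" "X = diagram_of n \<alpha>" "n + 1 = num_vertices n \<alpha> + 2 * g"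
      using fixed_genus_matching[OF X] .
    obtain \<beta> where b: "matching n \<beta>" "Y = diagram_of n \<beta>" "n + 1 = num_vertices n \<beta> + 2 * g"
      using fixed_genus_matching[OF Y] .
    have "reach n \<alpha> \<beta>"
    proof (rule matchings_connected[OF a(1) b(1) n(1)])
      show "num_vertices n \<alpha> = num_vertices n \<beta>" using a(3) b(3) by simp
      show "odd (n + num_vertices n \<alpha>)" using arg_cong[OF a(3), of even] by auto
      show "\<alpha> \<noteq> bolza_map n \<and> \<beta> \<noteq> bolza_map n" if "num_vertices n \<alpha> = 1"
        using nb a(2,3) b(2) that by (auto simp: bolza_diagram_of)
    qed
    then show ?thesis using accessible_if_reach[OF n(2) a(1)] X a(2) b(2) by simp
  qed
  show "irreducible_chain ?S ?P" if "real g < real n / 2"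
    unfolding irreducible_chain_def using access that by auto
  assume "real g = real n / 2"
  then have ng: "n = 2 * g" by linarith
  then have "even n" by simp
  let ?b = "bolza n"
  have bS: "?b \<in> ?S"
    unfolding bolza_diagram_of fixed_genus_iff[OF bolza_matching[OF n(1)]]
    using bolza_one_vertex[OF \<open>even n\<close> n(1)] ng by simp
  note zero = bolza_swap_chain_zero[OF ng n(1)]
  show "isolated_state ?S ?P ?b"
    using bS zero by (auto simp: isolated_state_def)
  \<comment> \<open>The second class must be inhabited: the Bolza diagram on \<open>n - 2\<close>
    chords with a handle attached has one vertex and contains a chord of length two.\<close>
  have ex: "?S - {?b} \<noteq> {}"
  proof -
    define m where "m = n - 2"
    have m: "n = m + 2" "m \<ge> 2" "even m" using assms(1) \<open>even n\<close> by (auto simp: m_def) presburger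
    have bm: "matching m (bolza_map m)" by (rule bolza_matching) (use m in simp)
    let ?h = "add_handle m (bolza_map m)"
    have mh: "matching n ?h" unfolding m(1) by (rule add_handle_matching[OF bm])
    have "num_vertices n ?h = 1"
      unfolding m(1) using num_vertices_add_handle[OF bm] bolza_one_vertex[OF m(3)] m(2) by simp
    then have "diagram_of n ?h \<in> ?S" unfolding fixed_genus_iff[OF mh] using ng by simp
    moreover have "?h (2 * m) \<noteq> bolza_map n (2 * m)"
      using m by (simp add: add_handle_apply[OF bm] bolza_map_eq)
    then have "diagram_of n ?h \<noteq> ?b"
      unfolding bolza_diagram_of using diagram_of_inj[OF mh bolza_matching[OF n(1)]] by metis
    ultimately show ?thesis by blast
  qed
  let ?R = "{(x, y). x \<in> ?S \<and> y \<in> ?S \<and> accessible ?S ?P x y \<and> accessible ?S ?P y x}"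
  have nacc: "\<not> accessible ?S ?P ?b y" if "y \<noteq> ?b" for y
    by (rule absorbing_not_accessible) (use zero that in auto)
  have "accessible ?S ?P ?b ?b" unfolding accessible_def by (rule exI[of _ 0]) simp
  then have Rb: "?R `` {?b} = {?b}" using nacc bS by auto
  have Rx: "?R `` {x} = ?S - {?b}" if "x \<in> ?S - {?b}" for x
    using that nacc access by auto
  have "?S // ?R = (\<lambda>x. ?R `` {x}) ` ?S" by (auto simp: quotient_def)
  also have "\<dots> = insert (?R `` {?b}) ((\<lambda>x. ?R `` {x}) ` (?S - {?b}))" using bS by blast
  also have "(\<lambda>x. ?R `` {x}) ` (?S - {?b}) = {?S - {?b}}"
    using ex Rx by (metis (no_types, lifting) image_cong image_constant_conv)
  finally show classes: "communicating_classes ?S ?P = {{?b}, ?S - {?b}}"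
    unfolding communicating_classes_def Rb .
  have "{?b} \<noteq> ?S - {?b}" by blast
  then show "card (communicating_classes ?S ?P) = 2" unfolding classes by simp
qed

end
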